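(* (1) An elementary flower of a hexagonal circle pattern is conformally symmetric if and only if the opposite intersection angles are equal (the central circle intersects the petals $C_i$ and $C_{i+3}$ at equal angles, $i=1,2,3$) and the six intersection points on the central circle have multi-ratio $-1$. (2) A hexagonal circle pattern is conformally symmetric if and only if it has constant intersection angles and for all circles the six intersection points on the circle have multi-ratio $-1$.
   Context: Let $\omega=e^{2\pi i/3}$, $\varepsilon=e^{\pi i/3}$. The regular hexagonal lattice has vertex set $V=\{k+\ell\omega+m\omega^2: k,\ell,m\in\mathbb Z,\ k+\ell+m\not\equiv0\bmod 3\}$, edges the pairs of vertices at distance 1, and hexagonal faces centered at $F=\{k+\ell\omega+m\omega^2:k+\ell+m\equiv0\bmod3\}$. A map $w:V\to\hat{\mathbb C}$ is a hexagonal circle pattern if for each $\mathfrak z'\in F$ the points $w(\mathfrak z'+\varepsilon^k)$, $k=1,\dots,6$, lie on a circle $C(\mathfrak z')$ in this circular order; here these six points are assumed distinct. Orient $C(\mathfrak z')$ by this order. If the hexagons centered at $\mathfrak z',\mathfrak z''$ share the edge $[\mathfrak z_k,\mathfrak z_{k+1}]$, $\mathfrak z_k=\mathfrak z'+\varepsilon^k$, then $C(\mathfrak z')$ and $C(\mathfrak z'')$ meet at $w(\mathfrak z_k),w(\mathfrak z_{k+1})$, and their intersection angle $\phi\in[0,2\pi)$ is given by $e^{i\phi}=-t''/t'$, where $t',t''$ are the unit tangents of the oriented circles at $w(\mathfrak z_k)$ (after a Möbius transformation if needed). The pattern has constant intersection angles if $\phi$ is constant on each of the three classes of parallel edges of the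 hexagonal lattice (endpoints differing by $\pm1$, $\pm\omega$, $\pm\omega^2$). The elementary flower of a circle $C$ consists of $C$ and its six neighboring circles (petals) $C_1,\dots,C_6$ in cyclic order. It is conformally symmetric if there is a Möbius involution of $\hat{\mathbb C}$ leaving $C$ invariant and sending $C_i$ to $C_{i+3}$ for all $i$ (indices mod 6). A hexagonal circle pattern is conformally symmetric if all its elementary flowers are. Multi-ratio of six points (taken in cyclic order on the circle): $m(z_1,\dots,z_6)=\dfrac{z_1-z_2}{z_2-z_3}\cdot\dfrac{z_3-z_4}{z_4-z_5}\cdot\dfrac{z_5-z_6}{z_6-z_1}$.
   Formalization: Each central circle is assumed different from its six petals (for the flower in (1), for all flowers in (2)); this excludes only patterns lying entirely on one circle, which are always conformally symmetric although their multi-ratios need not be -1. *)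

theory Defs
  imports "HOL-Analysis.Analysis"
begin

section \<open>The Riemann sphere\<close>

text \<open>The point at infinity is \<open>None\<close>, as in the library's one-point compactification.\<close>

type_synonym rsphere = "complex option"

fun moebius_map :: "complex \<Rightarrow> complex \<Rightarrow> complex \<Rightarrow> complex \<Rightarrow> rsphere \<Rightarrow> rsphere" where
  "moebius_map a b c d None = (if c = 0 then None else Some (a / c))"
| "moebius_map a b c d (Some z) =
     (if c * z + d = 0 then None else Some ((a * z + b) / (c * z + d)))"

definition moebius :: "(rsphere \<Rightarrow> rsphere) \<Rightarrow> bool" where
  "moebius T \<longleftrightarrow> (\<exists>a b c d. a * d - b * c \<noteq> 0 \<and> T = moebius_map a b c d)"

definition moebius_involution :: "(rsphere \<Rightarrow> rsphere) \<Rightarrow> bool" where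
  "moebius_involution T \<longleftrightarrow> moebius T \<and> T \<circ> T = id \<and> T \<noteq> id"

definition extended_reals :: "rsphere set" where
  "extended_reals = insert None (range (\<lambda>x::real. Some (of_real x)))"

text \<open>Circles of the sphere are the Euclidean circles together with the lines completed by
  infinity, i.e. the Moebius images of the extended real line.\<close>

definition is_circle :: "rsphere set \<Rightarrow> bool" where
  "is_circle C \<longleftrightarrow> (\<exists>G. moebius G \<and> C = G ` extended_reals)"

text \<open>A Moebius map \<open>G\<close>, restricted to the extended real line with its positive direction, is a
  parametrised oriented circle. Six distinct points lie on a circle in the cyclic order
  \<open>p 1, \<dots>, p 6\<close> iff some such \<open>G\<close> runs through them in this order (put infinity on the arc between
  \<open>p 6\<close> and \<open>p 1\<close>); the orientation of the circle by this cyclic order is then the one given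
  by \<open>G\<close>.\<close>

definition runs_through :: "(rsphere \<Rightarrow> rsphere) \<Rightarrow> (nat \<Rightarrow> rsphere) \<Rightarrow> bool" where
  "runs_through G p \<longleftrightarrow> moebius G \<and>
     (\<exists>t::nat \<Rightarrow> real. strict_mono_on {1..6} t \<and> (\<forall>k\<in>{1..6}. p k = G (Some (of_real (t k)))))"

text \<open>Only used at parameters \<open>s\<close> with \<open>G s\<close> finite; then \<open>G\<close> is finite near \<open>s\<close>.\<close>

definition unit_tangent :: "(rsphere \<Rightarrow> rsphere) \<Rightarrow> real \<Rightarrow> complex" where
  "unit_tangent G s = sgn (vector_derivative (\<lambda>x::real. the (G (Some (of_real x)))) (at s))"

text \<open>The difference of two points, as the determinant of the homogeneous coordinates \<open>(z, 1)\<close> of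
  \<open>z\<close> and \<open>(1, 0)\<close> of infinity. Each point enters the multi-ratio once in the numerator and once
  in the denominator, so this is the continuous extension of the usual formula to the case that
  one of the points is infinity.\<close>

fun sdiff :: "rsphere \<Rightarrow> rsphere \<Rightarrow> complex" where
  "sdiff (Some a) (Some b) = a - b"
| "sdiff (Some a) None = - 1"
| "sdiff None (Some b) = 1"
| "sdiff None None = 0"

definition multi_ratio ::
  "rsphere \<Rightarrow> rsphere \<Rightarrow> rsphere \<Rightarrow> rsphere \<Rightarrow> rsphere \<Rightarrow> rsphere \<Rightarrow> complex" where
  "multi_ratio z1 z2 z3 z4 z5 z6 =
     (sdiff z1 z2 / sdiff z2 z3) * (sdiff z3 z4 / sdiff z4 z5) * (sdiff z5 z6 / sdiff z6 z1)"

section \<open>Hexagonal circle patterns\<close>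

definition \<omega> :: complex where "\<omega> = cis (2 * pi / 3)"

definition \<epsilon> :: complex where "\<epsilon> = cis (pi / 3)"

definition hex_vertices :: "complex set" where
  "hex_vertices = {of_int k + of_int l * \<omega> + of_int m * \<omega>\<^sup>2 | k l m :: int. (k + l + m) mod 3 \<noteq> 0}"

definition hex_faces :: "complex set" where
  "hex_faces = {of_int k + of_int l * \<omega> + of_int m * \<omega>\<^sup>2 | k l m :: int. (k + l + m) mod 3 = 0}"

text \<open>A pattern is a map \<open>w\<close> on \<open>hex_vertices\<close>, given here as a total function. Its values elsewhere
  are never used: for \<open>z \<in> hex_faces\<close> all \<open>z + \<epsilon> ^ k\<close> are in \<open>hex_vertices\<close>. Since \<open>\<epsilon> ^ 6 = 1\<close>,
  indices \<open>k\<close> are automatically modulo 6.\<close>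

definition corner :: "(complex \<Rightarrow> rsphere) \<Rightarrow> complex \<Rightarrow> nat \<Rightarrow> rsphere" where
  "corner w z k = w (z + \<epsilon> ^ k)"

definition hexagonal_circle_pattern :: "(complex \<Rightarrow> rsphere) \<Rightarrow> bool" where
  "hexagonal_circle_pattern w \<longleftrightarrow> (\<forall>z\<in>hex_faces. \<exists>G. runs_through G (corner w z))"

definition circle_at :: "(complex \<Rightarrow> rsphere) \<Rightarrow> complex \<Rightarrow> rsphere set" where
  "circle_at w z = (THE C. is_circle C \<and> (\<forall>k\<in>{1..6}. corner w z k \<in> C))"

text \<open>The centre of the hexagon sharing the edge from \<open>z + \<epsilon> ^ k\<close> to \<open>z + \<epsilon> ^ (k + 1)\<close> with the
  hexagon centred at \<open>z\<close>; \<open>z\<close> and \<open>petal z k\<close> are mirror images in the midpoint of this edge.\<close>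

definition petal :: "complex \<Rightarrow> nat \<Rightarrow> complex" where
  "petal z k = z + \<epsilon> ^ k + \<epsilon> ^ (k + 1)"

text \<open>The angle at which the oriented circles at \<open>z\<close> and \<open>petal z k\<close> meet at \<open>corner w z k\<close>. The
  Moebius map \<open>S\<close> moves this point away from infinity; the quotient of the tangents depends
  neither on \<open>S\<close> nor on the parametrisations.\<close>

definition intersection_angle :: "(complex \<Rightarrow> rsphere) \<Rightarrow> complex \<Rightarrow> nat \<Rightarrow> real" where
  "intersection_angle w z k = (THE \<phi>. 0 \<le> \<phi> \<and> \<phi> < 2 * pi \<and>
     (\<exists>S G' G'' s' s''. moebius S \<and> S (corner w z k) \<noteq> None \<and>
        runs_through G' (corner w z) \<and> G' (Some (of_real s')) = corner w z k \<and>
        runs_through G'' (corner w (petal z k)) \<and> G'' (Some (of_real s'')) = corner w z k \<and>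
        cis \<phi> = - unit_tangent (S \<circ> G'') s'' / unit_tangent (S \<circ> G') s'))"

definition constant_intersection_angles :: "(complex \<Rightarrow> rsphere) \<Rightarrow> bool" where
  "constant_intersection_angles w \<longleftrightarrow> (\<forall>u\<in>{1, \<omega>, \<omega>\<^sup>2}. \<exists>\<phi>. \<forall>z\<in>hex_faces. \<forall>k\<in>{1..6}.
     (z + \<epsilon> ^ (k + 1)) - (z + \<epsilon> ^ k) \<in> {u, - u} \<longrightarrow> intersection_angle w z k = \<phi>)"

definition conformally_symmetric_flower :: "(complex \<Rightarrow> rsphere) \<Rightarrow> complex \<Rightarrow> bool" where
  "conformally_symmetric_flower w z \<longleftrightarrow> (\<exists>T. moebius_involution T \<and>
     T ` circle_at w z = circle_at w z \<and>
     (\<forall>k\<in>{1..6}. T ` circle_at w (petal z k) = circle_at w (petal z (k + 3))))"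

definition conformally_symmetric_pattern :: "(complex \<Rightarrow> rsphere) \<Rightarrow> bool" where
  "conformally_symmetric_pattern w \<longleftrightarrow> (\<forall>z\<in>hex_faces. conformally_symmetric_flower w z)"

definition corner_multi_ratio :: "(complex \<Rightarrow> rsphere) \<Rightarrow> complex \<Rightarrow> complex" where
  "corner_multi_ratio w z = multi_ratio (corner w z 1) (corner w z 2) (corner w z 3)
     (corner w z 4) (corner w z 5) (corner w z 6)"

text \<open>The central circle and each petal are two different circles, so that they do intersect in
  just two points. Without this, the images of the corners under a symmetry of the flower are not
  determined: any pattern whose values all lie on one circle would have only conformally symmetric
  flowers, whatever the multi-ratios.\<close>

definition proper_flower :: "(complex \<Rightarrow> rsphere) \<Rightarrow> complex \<Rightarrow> bool" where
  "proper_flower w z \<longleftrightarrow> (\<forall>k\<in>{1..6}. circle_at w (petal z k) \<noteq> circle_at w z)"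

end

theory Submission
  imports Defs
begin

text \<open>The proof rests on one observation: if two oriented circles of the pattern meet at
the vertices \<open>p\<close> and \<open>q\<close>, their intersection angle is the argument of the cross-ratio of
\<open>p\<close>, \<open>q\<close> and one further vertex on each circle. To see this, send \<open>p\<close> to 0 and \<open>q\<close> to
infinity; the circles become lines, whose directions are given by the two other points.
After \<open>intersection_angle_eq\<close> no derivatives occur any more, and the statements are about
cross-ratios of the vertices.

A symmetry of a flower maps the circles to the opposite ones. If the petals differ from the
central circle, the vertices on them are determined as intersection points, so the symmetry
maps vertices to opposite vertices and preserves cross-ratios; hence opposite angles agree.
It shifts the six points on the central circle by three and thereby inverts their
multi-ratio, which is real and negative by the cyclic order, hence -1 (\<open>symmetric_flowerD\<close>).
Conversely, the multi-ratio is -1 exactly if the involution that swaps two pairs of opposite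
corners also swaps the third pair (\<open>involution_swapping_pairs\<close>), and a circle through two
corners is determined by its angle with the central circle (\<open>symmetric_flowerI\<close>).

It remains to compare equality of opposite angles in every flower with constancy on classes
of parallel edges. The former only gives constancy along strips of hexagons. To pass from a
strip to the next one, write each angle \<open>\<phi>\<close> as \<open>cis \<phi>\<close>. The three values at a vertex have
the product -1 (\<open>angle_unit_product_at_vertex\<close>), and this forces the values in neighbouring
strips to be equal up to a sign. The sign cannot be ruled out by such equations. It is ruled
out by the cyclic order of the vertices on the circles: around one hexagon all angles are
less than \<open>pi\<close>, or all are greater than \<open>pi\<close> (\<open>angle_units_same_half_plane\<close>), while a change
of sign would affect only two of the three classes (\<open>opposite_angles_shift_invariant\<close>). \<close>

section \<open>Moebius maps, cross-ratios and circles\<close>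

lemma sdiff_eq_0_iff: "sdiff x y = 0 \<longleftrightarrow> x = y"
  by (cases x; cases y) auto

lemma sdiff_swap: "sdiff y x = - sdiff x y"
  by (cases x; cases y) auto

text \<open>The three-term relation between 2x2 minors of the homogeneous coordinates of four
points. It links the cross-ratios that arise from different orders of the same four points.\<close>

lemma sdiff_pluecker:
  "sdiff a b * sdiff c d - sdiff a c * sdiff b d + sdiff a d * sdiff b c = 0"
  by (cases a; cases b; cases c; cases d) (auto simp: algebra_simps)

lemma moebius_map_compose:
  assumes "a * d - b * c \<noteq> 0" "a' * d' - b' * c' \<noteq> 0"
  shows "moebius_map a b c d (moebius_map a' b' c' d' x) =
    moebius_map (a * a' + b * c') (a * b' + b * d') (c * a' + d * c') (c * b' + d * d') x"
proof (cases x)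
  case None
  have "c * a' + d * c' = 0 \<Longrightarrow> c' = 0 \<Longrightarrow> c = 0"
    using assms by auto
  moreover have "c * a' + d * c' = (c * (a' / c') + d) * c'" if "c' \<noteq> 0"
    using that by (simp add: field_simps)
  moreover have "a * a' + b * c' = (a * (a' / c') + b) * c'" if "c' \<noteq> 0"
    using that by (simp add: field_simps)
  ultimately show ?thesis
    using None assms by (cases "c' = 0") auto
next
  case (Some z)
  define u v where "u = a' * z + b'" and "v = c' * z + d'"
  have *: "(a * a' + b * c') * z + (a * b' + b * d') = a * u + b * v"
      "(c * a' + d * c') * z + (c * b' + d * d') = c * u + d * v"
    by (auto simp: u_def v_def algebra_simps)
  have "u \<noteq> 0" if "v = 0"
  proof
    assume "u = 0"
    have "a' * d' - b' * c' = 0" using that \<open>u = 0\<close> unfolding u_def v_def by algebra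
    with assms show False by simp
  qed
  moreover have "c * u + d * v = (c * (u / v) + d) * v" "a * u + b * v = (a * (u / v) + b) * v"
    if "v \<noteq> 0" using that by (simp_all add: field_simps)
  ultimately show ?thesis
    using Some assms unfolding Some moebius_map.simps * by (cases "v = 0") (auto simp: u_def[symmetric] v_def[symmetric])
qed

lemma moebius_compose:
  assumes "moebius S" "moebius T"
  shows "moebius (S \<circ> T)"
proof -
  obtain a b c d where S: "a * d - b * c \<noteq> 0" "S = moebius_map a b c d"
    using assms by (auto simp: moebius_def)
  obtain a' b' c' d' where T: "a' * d' - b' * c' \<noteq> 0" "T = moebius_map a' b' c' d'"
    using assms by (auto simp: moebius_def)
  have "(a * a' + b * c') * (c * b' + d * d') - (a * b' + b * d') * (c * a' + d * c') =
      (a * d - b * c) * (a' * d' - b' * c')" by algebra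
  then show ?thesis
    unfolding moebius_def using S T moebius_map_compose[OF S(1) T(1)]
    by (intro exI[of _ "a * a' + b * c'"] exI[of _ "a * b' + b * d'"]
          exI[of _ "c * a' + d * c'"] exI[of _ "c * b' + d * d'"]) (auto simp: fun_eq_iff)
qed

lemma moebius_map_scalar: "e \<noteq> 0 \<Longrightarrow> moebius_map e 0 0 e = id"
proof
  fix x show "e \<noteq> 0 \<Longrightarrow> moebius_map e 0 0 e x = id x" by (cases x) auto
qed

lemma moebius_inverse:
  assumes "moebius T"
  obtains T' where "moebius T'" "\<And>x. T' (T x) = x" "\<And>x. T (T' x) = x"
proof -
  obtain a b c d where T: "a * d - b * c \<noteq> 0" "T = moebius_map a b c d"
    using assms by (auto simp: moebius_def)
  have T': "d * a - (- b) * (- c) \<noteq> 0" using T by (simp add: algebra_simps)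
  have e: "moebius_map (a * d - b * c) 0 0 (a * d - b * c) x = x" for x
    using moebius_map_scalar[OF T(1)] by simp
  have "moebius_map d (- b) (- c) a (T x) = x" for x
    unfolding T(2) moebius_map_compose[OF T' T(1)] using e[of x] by (simp add: algebra_simps)
  moreover have "T (moebius_map d (- b) (- c) a x) = x" for x
    unfolding T(2) moebius_map_compose[OF T(1) T'] using e[of x] by (simp add: algebra_simps)
  moreover have "moebius (moebius_map d (- b) (- c) a)" unfolding moebius_def using T' by blast
  ultimately show ?thesis using that by blast
qed

lemma moebius_inj: "moebius T \<Longrightarrow> T x = T y \<longleftrightarrow> x = y"
  by (metis moebius_inverse)

text \<open>On homogeneous coordinates a Moebius map acts by a matrix of determinant \<open>D\<close> followed
by a rescaling \<open>l\<close> of each vector, so the invariance of a quotient of such differences is a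
cancellation of factors, also if one of the points is infinity.\<close>

lemma moebius_sdiff:
  assumes "moebius T"
  obtains D l where "D \<noteq> 0" "\<And>x. l x \<noteq> 0"
    "\<And>x y. sdiff (T x) (T y) = D * l x * l y * sdiff x y"
proof -
  obtain a b c d where T: "a * d - b * c \<noteq> 0" "T = moebius_map a b c d"
    using assms by (auto simp: moebius_def)
  define h where "h x y = (if y = 0 then 1 / x else 1 / y)" for x y :: complex
  define l where "l x = (case x of None \<Rightarrow> h a c | Some z \<Rightarrow> h (a * z + b) (c * z + d))" for x
  have nz: "a * z + b \<noteq> 0" if "c * z + d = 0" for z
  proof
    assume "a * z + b = 0"
    have "a * d - b * c = 0" using that \<open>a * z + b = 0\<close> by algebra
    with T show False by simp
  qed
  have *: "a \<noteq> 0" if "c = 0" using T(1) that by auto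
  have "l x \<noteq> 0" for x using nz * by (cases x) (auto simp: l_def h_def)
  moreover have "sdiff (T x) (T y) = (a * d - b * c) * l x * l y * sdiff x y" for x y
  proof (cases x; cases y)
    fix u v assume [simp]: "x = Some u" "y = Some v"
    have e: "(a * u + b) * (c * v + d) - (c * u + d) * (a * v + b) = (a * d - b * c) * (u - v)"
      by algebra
    show ?thesis
      using nz[of u] nz[of v] e
      by (auto simp: T l_def h_def divide_simps) (auto simp: algebra_simps)
  next
    fix u assume xy: "x = Some u" "y = None"
    define U V where "U = a * u + b" and "V = c * u + d"
    have e: "a * d - b * c = V * a - U * c" unfolding U_def V_def by algebra
    have lx: "l x = h U V" "l y = h a c" "T x = (if V = 0 then None else Some (U / V))"
      "T y = (if c = 0 then None else Some (a / c))"
      by (simp_all add: xy l_def U_def V_def T)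
    have "V * a - U * c \<noteq> 0" using T(1) e by simp
    then show ?thesis unfolding lx e unfolding xy
      by (cases "V = 0"; cases "c = 0") (auto simp: h_def divide_simps)
  next
    fix u assume xy: "y = Some u" "x = None"
    define U V where "U = a * u + b" and "V = c * u + d"
    have e: "a * d - b * c = V * a - U * c" unfolding U_def V_def by algebra
    have lx: "l y = h U V" "l x = h a c" "T y = (if V = 0 then None else Some (U / V))"
      "T x = (if c = 0 then None else Some (a / c))"
      by (simp_all add: xy l_def U_def V_def T)
    have "V * a - U * c \<noteq> 0" using T(1) e by simp
    then show ?thesis unfolding lx e unfolding xy
      by (cases "V = 0"; cases "c = 0") (auto simp: h_def divide_simps)
  next
    assume [simp]: "y = None" "x = None"
    show ?thesis by (simp add: T)
  qed
  ultimately show ?thesis using that T(1) by blast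
qed

lemma moebius_id: "moebius id"
  unfolding moebius_def using moebius_map_scalar[of 1] by (metis mult_cancel_left1 diff_zero mult_zero_left zero_neq_one)

lemma moebius_finite_at: obtains S where "moebius S" "S p \<noteq> None"
proof (cases p)
  case None
  have "moebius (moebius_map 0 1 1 0)" unfolding moebius_def by (metis diff_0 mult_1 mult_zero_left neg_equal_0_iff_equal zero_neq_one)
  then show ?thesis using that None by fastforce
next
  case Some
  then show ?thesis using that moebius_id by fastforce
qed

text \<open>The points \<open>a\<close> and \<open>b\<close> are the ones that are sent to 0 and infinity: in that
coordinate the value is \<open>c / d\<close>. With this choice the angle of two circles through \<open>a\<close> and
\<open>b\<close> is the argument of the cross-ratio, up to orientations, if \<open>c\<close> is taken on one circle
and \<open>d\<close> on the other.\<close>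

definition cross_ratio :: "rsphere \<Rightarrow> rsphere \<Rightarrow> rsphere \<Rightarrow> rsphere \<Rightarrow> complex" where
  "cross_ratio a b c d = (sdiff c a * sdiff d b) / (sdiff c b * sdiff d a)"

lemma cross_ratio_swap: "cross_ratio b a d c = cross_ratio a b c d"
  by (simp add: cross_ratio_def mult.commute)

lemma cross_ratio_nonzero:
  "c \<noteq> a \<Longrightarrow> c \<noteq> b \<Longrightarrow> d \<noteq> a \<Longrightarrow> d \<noteq> b \<Longrightarrow> cross_ratio a b c d \<noteq> 0"
  by (simp add: cross_ratio_def sdiff_eq_0_iff)

lemma moebius_cross_ratio:
  assumes "moebius T"
  shows "cross_ratio (T a) (T b) (T c) (T d) = cross_ratio a b c d"
  by (rule moebius_sdiff[OF assms]) (simp add: cross_ratio_def)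

lemma moebius_multi_ratio:
  assumes "moebius T"
  shows "multi_ratio (T a) (T b) (T c) (T d) (T e) (T f) = multi_ratio a b c d e f"
  by (rule moebius_sdiff[OF assms]) (simp add: multi_ratio_def mult.assoc)

lemma is_circle_image: "moebius T \<Longrightarrow> is_circle C \<Longrightarrow> is_circle (T ` C)"
  unfolding is_circle_def by (metis image_comp moebius_compose)

lemma extended_reals_iff_cross_ratio:
  assumes "p \<in> extended_reals" "q \<in> extended_reals" "r \<in> extended_reals"
    and "p \<noteq> q" "p \<noteq> r" "q \<noteq> r"
  shows "x \<in> extended_reals \<longleftrightarrow> cross_ratio p q r x \<in> \<real>"
proof (cases x)
  case None
  then show ?thesis using assms by (auto simp: extended_reals_def cross_ratio_def)
next
  case (Some z)
  have x: "x \<in> extended_reals \<longleftrightarrow> z \<in> \<real>"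
    by (auto simp: Some extended_reals_def Reals_def)
  have cr: "cross_ratio p q r x = (sdiff r p / sdiff r q) * (sdiff x q / sdiff x p)"
    by (simp add: cross_ratio_def)
  have R: "sdiff u v \<in> \<real>" if "u \<in> extended_reals" "v \<in> extended_reals" for u v
    using that by (auto simp: extended_reals_def)
  define m where "m = sdiff r p / sdiff r q"
  have m: "m \<in> \<real>" "m \<noteq> 0"
    using assms R by (auto simp: sdiff_eq_0_iff m_def)
  have mm: "m * y \<in> \<real> \<longleftrightarrow> y \<in> \<real>" for y
    using m by (metis Reals_divide Reals_mult nonzero_mult_div_cancel_left)
  have "sdiff x q / sdiff x p \<in> \<real> \<longleftrightarrow> z \<in> \<real>"
  proof (cases p)
    case None
    then obtain s where "q = Some (of_real s)" using assms by (auto simp: extended_reals_def)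
    then show ?thesis using None Some by (simp add: complex_is_Real_iff)
  next
    case p: (Some p')
    then obtain s where s: "p' = of_real s" using assms by (auto simp: extended_reals_def)
    show ?thesis
    proof (cases q)
      case None
      have "z - of_real s \<in> \<real> \<longleftrightarrow> z \<in> \<real>" by (simp add: complex_is_Real_iff)
      moreover have "1 / y \<in> \<real> \<longleftrightarrow> y \<in> \<real>" for y :: complex
        by (metis Reals_1 Reals_divide div_by_1 divide_divide_eq_right mult_1)
      ultimately show ?thesis using None Some p s by auto
    next
      case q: (Some q')
      then obtain u where u: "q' = of_real u" using assms by (auto simp: extended_reals_def)
      have "u \<noteq> s" using assms p q s u by auto
      have "Im (sdiff x q / sdiff x p) = (u - s) * Im z / ((Re z - s)\<^sup>2 + (Im z)\<^sup>2)"
        by (simp add: Some p q s u Im_divide divide_simps) (simp add: algebra_simps)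
      moreover have "Im z = 0" if "(Re z - s)\<^sup>2 + (Im z)\<^sup>2 = 0"
        using that by (simp add: sum_power2_eq_zero_iff)
      ultimately show ?thesis using \<open>u \<noteq> s\<close> by (auto simp: complex_is_Real_iff)
    qed
  qed
  then show ?thesis unfolding x cr m_def[symmetric] mm ..
qed

text \<open>Pulling the circle back to the extended real line, where \<open>p\<close>, \<open>q\<close>, \<open>r\<close> become real,
reduces this to the case of that line. The point \<open>x = p\<close> is covered because division by 0
yields 0, which is real.\<close>

lemma circle_iff_cross_ratio_real:
  assumes "is_circle C" "p \<in> C" "q \<in> C" "r \<in> C" "p \<noteq> q" "p \<noteq> r" "q \<noteq> r"
  shows "x \<in> C \<longleftrightarrow> cross_ratio p q r x \<in> \<real>"
proof -
  obtain G where G: "moebius G" "C = G ` extended_reals"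
    using assms(1) by (auto simp: is_circle_def)
  obtain H where H: "\<And>y. H (G y) = y" "\<And>y. G (H y) = y" "moebius H"
    using moebius_inverse[OF G(1)] by metis
  have mem: "y \<in> C \<longleftrightarrow> H y \<in> extended_reals" for y
    using G(2) H by (metis image_iff)
  have neq: "H y \<noteq> H y'" if "y \<noteq> y'" for y y' using that moebius_inj[OF H(3)] by simp
  have "H x \<in> extended_reals \<longleftrightarrow> cross_ratio (H p) (H q) (H r) (H x) \<in> \<real>"
    using assms by (intro extended_reals_iff_cross_ratio) (auto simp: mem neq)
  then show ?thesis unfolding mem moebius_cross_ratio[OF H(3)] .
qed

lemma circle_unique:
  assumes "is_circle C" "p \<in> C" "q \<in> C" "r \<in> C"
    and "is_circle C'" "p \<in> C'" "q \<in> C'" "r \<in> C'"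
    and "p \<noteq> q" "p \<noteq> r" "q \<noteq> r"
  shows "C = C'"
  using circle_iff_cross_ratio_real[OF assms(1-4,9-)] circle_iff_cross_ratio_real[OF assms(5-8,9-)]
  by blast

section \<open>Cyclic order and tangents of oriented circles\<close>

text \<open>Three real parameters are in the cyclic order of the oriented extended real line iff
the product below is positive, wherever infinity is put between them. So this relation,
unlike the order of the parameters, is invariant under cyclic permutation.\<close>

definition cyclic_on :: "(rsphere \<Rightarrow> rsphere) \<Rightarrow> rsphere \<Rightarrow> rsphere \<Rightarrow> rsphere \<Rightarrow> bool" where
  "cyclic_on G x y z \<longleftrightarrow> (\<exists>a b c :: real. x = G (Some (of_real a)) \<and> y = G (Some (of_real b)) \<and>
     z = G (Some (of_real c)) \<and> 0 < (b - a) * (c - b) * (c - a))"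

text \<open>All data of a flower are indexed modulo 6, while the definitions only speak about the
indices from 1 to 6.\<close>

lemma periodic_all:
  fixes P :: "nat \<Rightarrow> bool"
  assumes "\<And>k. k \<in> {1..6} \<Longrightarrow> P k" "\<And>k. P (k + 6) \<longleftrightarrow> P k"
  shows "P k"
proof (induction k rule: less_induct)
  case (less k)
  consider "k = 0" | "k \<in> {1..6}" | "k - 6 < k" "k = (k - 6) + 6" by force
  then show ?case
  proof cases
    case 1
    then show ?thesis using assms(1)[of 6] assms(2)[of 0] by simp
  next
    case 2
    then show ?thesis by (rule assms(1))
  next
    case 3
    then show ?thesis using less assms(2) by metis
  qed
qed

text \<open>The parameters are continued with period 6. Going once around from index \<open>i\<close>, the
parameters drop at most once, so any three of them with indices less than 6 apart stay in
cyclic order.\<close>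

lemma runs_through_parameter:
  fixes p :: "nat \<Rightarrow> rsphere"
  assumes "runs_through G p" "\<And>k. p (k + 6) = p k"
  obtains t where "\<And>k. p k = G (Some (of_real (t k)))"
    "\<And>i j l. i < j \<Longrightarrow> j < l \<Longrightarrow> l < i + 6 \<Longrightarrow> 0 < (t j - t i) * (t l - t j) * (t l - t i)"
proof -
  obtain u where u: "strict_mono_on {1..6} u" "\<And>k. k \<in> {1..6} \<Longrightarrow> p k = G (Some (of_real (u k)))"
    using assms(1) by (auto simp: runs_through_def)
  \<comment> \<open>the representative modulo 6 in the range from 1 to 6\<close>
  define s where "s k = (k + 5) mod 6 + 1" for k :: nat
  have s: "s k \<in> {1..6}" for k by (auto simp: s_def Suc_le_eq)
  have s_id: "s k = k" if "k \<in> {1..6}" for k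
  proof -
    have e: "k + 5 = (k - 1) + 6" and "k - 1 < 6" using that by auto
    then have "(k + 5) mod 6 = k - 1" unfolding e by simp
    then show ?thesis using that by (simp add: s_def)
  qed
  have 1: "p k = G (Some (of_real (u (s k))))" for k
  proof (rule periodic_all[where P = "\<lambda>k. p k = G (Some (of_real (u (s k))))"])
    show "p (k + 6) = G (Some (of_real (u (s (k + 6))))) \<longleftrightarrow> p k = G (Some (of_real (u (s k))))" for k
    proof -
      have "s (k + 6) = s k" using mod_add_self2[of "k + 5" 6] by (simp add: s_def)
      then show ?thesis using assms(2) by simp
    qed
  qed (use u(2) s_id in simp)
  have lt: "u i < u j" if "i < j" "i \<in> {1..6}" "j \<in> {1..6}" for i j
    using u(1) that by (auto simp: strict_mono_on_def)
  have 2: "0 < (u (s j) - u (s i)) * (u (s l) - u (s j)) * (u (s l) - u (s i))"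
    if "i < j" "j < l" "l < i + 6" for i j l
  proof -
    have "s i < s j \<and> s j < s l \<or> s j < s l \<and> s l < s i \<or> s l < s i \<and> s i < s j"
    proof -
      have wrap: "x mod 6 = (if x < 6 then x else x - 6)" if "x < 12" for x :: nat
        using that by (simp add: le_mod_geq)
      define a where "a = (i + 5) mod 6"
      have shift: "(i + d + 5) mod 6 = (a + d) mod 6" for d
        unfolding a_def by (simp add: mod_simps ac_simps)
      define d where "d = j - i"
      define e where "e = l - i"
      have a: "a < 6" "0 < d" "d < e" "e < 6"
        using that by (auto simp: a_def d_def e_def)
      have s_eqs: "s i = a + 1" "s j = (a + d) mod 6 + 1" "s l = (a + e) mod 6 + 1"
        using shift[of d] shift[of e] that by (simp_all add: s_def a_def d_def e_def)
      have m: "(a + d) mod 6 = (if a + d < 6 then a + d else a + d - 6)"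
          "(a + e) mod 6 = (if a + e < 6 then a + e else a + e - 6)"
        by (rule wrap, use a in linarith)+
      consider "a + e < 6" "a + d < 6" | "a + d < 6" "\<not> a + e < 6"
        | "\<not> a + d < 6" "\<not> a + e < 6"
        using a by linarith
      then show ?thesis
      proof cases
        case 1
        then have "s i < s j \<and> s j < s l" using a unfolding s_eqs m by simp
        then show ?thesis by blast
      next
        case 2
        then have "s l < s i \<and> s i < s j" using a unfolding s_eqs m by simp
        then show ?thesis by blast
      next
        case 3
        then have "s j < s l \<and> s l < s i" using a unfolding s_eqs m by (simp; arith)
        then show ?thesis by blast
      qed
    qed
    moreover have "0 < (b - a) * (c - b) * (c - a)"
      if "a < b \<and> b < c \<or> b < c \<and> c < a \<or> c < a \<and> a < b" for a b c :: real
      using that by (auto simp: zero_less_mult_iff mult_less_0_iff)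
    ultimately show ?thesis using lt[OF _ s s, of i j] lt[OF _ s s, of j l] lt[OF _ s s, of l i] by blast
  qed
  show ?thesis by (rule that[of "\<lambda>k. u (s k)", OF 1 2])
qed

lemma runs_through_cyclic:
  assumes "runs_through G p" "\<And>k. p (k + 6) = p k" "i < j" "j < l" "l < i + 6"
  shows "cyclic_on G (p i) (p j) (p l)"
proof (rule runs_through_parameter[where G = G and p = p, OF assms(1,2)])
  fix t :: "nat \<Rightarrow> real"
  assume t: "\<And>k. p k = G (Some (of_real (t k)))"
    "\<And>i j l. i < j \<Longrightarrow> j < l \<Longrightarrow> l < i + 6 \<Longrightarrow> 0 < (t j - t i) * (t l - t j) * (t l - t i)"
  show "cyclic_on G (p i) (p j) (p l)"
    unfolding cyclic_on_def using t(1) t(2)[OF assms(3-)] by blast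
qed

lemma cyclic_on_rotate: "cyclic_on G x y z \<Longrightarrow> cyclic_on G y z x"
proof -
  have "(c - b) * (a - c) * (a - b) = (b - a) * (c - b) * (c - a)" for a b c :: real
    by algebra
  then show "cyclic_on G x y z \<Longrightarrow> cyclic_on G y z x" unfolding cyclic_on_def by metis
qed

lemma cyclic_on_distinct:
  assumes "moebius G" "cyclic_on G x y z"
  shows "x \<noteq> y" "y \<noteq> z" "x \<noteq> z"
  using assms(2) by (auto simp: cyclic_on_def moebius_inj[OF assms(1)])

text \<open>The difference of the points with parameters \<open>x\<close> and \<open>y\<close> is \<open>D (x - y)\<close>, with \<open>D\<close> the
determinant of \<open>H\<close>, divided by the denominators \<open>N\<close> at \<open>x\<close> and \<open>y\<close>. In
\<open>(V - P) (Q - P) / (V - Q)\<close> the denominators of \<open>Q\<close> and \<open>V\<close> cancel and what remains is the derivative \<open>D / N\<^sup>2\<close> at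
\<open>P\<close> times a real number, which is positive by the cyclic order. Thus a tangent direction can
be read off from three points of an oriented circle.\<close>

lemma unit_tangent_eq:
  assumes "moebius H" "cyclic_on H P Q V"
  obtains s where "P = H (Some (of_real s))"
   "P \<noteq> None \<Longrightarrow> unit_tangent H s = sgn (sdiff V P * sdiff Q P / sdiff V Q)"
proof -
  obtain a b c d where H: "a * d - b * c \<noteq> 0" "H = moebius_map a b c d"
    using assms by (auto simp: moebius_def)
  obtain s q v :: real where PQV: "P = H (Some (of_real s))" "Q = H (Some (of_real q))"
    "V = H (Some (of_real v))" and pos: "0 < (q - s) * (v - q) * (v - s)"
    using assms(2) by (auto simp: cyclic_on_def)
  define D where "D = a * d - b * c"
  show ?thesis
  proof (rule that[OF PQV(1)])
    assume "P \<noteq> None"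
    define N where "N x = c * of_real x + d" for x :: real
    define M where "M x = a * of_real x + b" for x :: real
    have Hx: "H (Some (of_real x)) = (if N x = 0 then None else Some (M x / N x))" for x
      by (simp add: H(2) N_def M_def)
    have Ns: "N s \<noteq> 0" using \<open>P \<noteq> None\<close> by (auto simp: PQV Hx)
    have MN: "M x * N y - M y * N x = D * (of_real x - of_real y)" for x y
      unfolding M_def N_def D_def by algebra
    have "((\<lambda>x. (a * of_real x + b) / (c * of_real x + d)) has_vector_derivative D / (N s)\<^sup>2) (at s)"
    proof (rule has_vector_derivative_real_field)
      show "((\<lambda>x. (a * x + b) / (c * x + d)) has_field_derivative D / (N s)\<^sup>2) (at (of_real s))"
        using Ns unfolding N_def D_def
        by (auto intro!: derivative_eq_intros simp: power2_eq_square divide_simps) (auto simp: algebra_simps)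
    qed
    moreover have "open {x. N x \<noteq> 0}"
      unfolding N_def by (intro open_Collect_neq continuous_intros)
    ultimately have "((\<lambda>x::real. the (H (Some (of_real x)))) has_vector_derivative D / (N s)\<^sup>2) (at s)"
      using Ns by (elim has_vector_derivative_transform_within_open) (auto simp: Hx M_def N_def)
    then have 1: "unit_tangent H s = sgn (D / (N s)\<^sup>2)"
      unfolding unit_tangent_def by (simp add: vector_derivative_at)
    define lam where "lam x = (if N x = 0 then 1 / M x else 1 / N x)" for x
    have M0: "M x \<noteq> 0" if "N x = 0" for x
    proof
      assume "M x = 0"
      have "a * d - b * c = 0" using that \<open>M x = 0\<close> unfolding M_def N_def by algebra
      with H show False by simp
    qed
    have lam: "lam x \<noteq> 0" for x using M0 by (simp add: lam_def)
    have sd: "sdiff (H (Some (of_real x))) (H (Some (of_real y))) = D * lam x * lam y * (of_real x - of_real y)" for x y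
    proof -
      have "sdiff (H (Some (of_real x))) (H (Some (of_real y))) = (M x * N y - M y * N x) * lam x * lam y"
        using M0[of x] M0[of y] by (auto simp: Hx lam_def divide_simps)
      then show ?thesis by (simp add: MN)
    qed
    have D: "D \<noteq> 0" using H D_def by simp
    have ls: "lam s = 1 / N s" using Ns by (simp add: lam_def)
    have nz: "s \<noteq> q" "v \<noteq> q" "v \<noteq> s" using pos by auto
    have "sdiff V P * sdiff Q P / sdiff V Q = (D / (N s)\<^sup>2) * of_real ((v - s) * (q - s) / (v - q))"
      unfolding PQV sd using lam D nz by (simp add: ls power2_eq_square mult_ac)
    moreover have "0 < (v - s) * (q - s) / (v - q)" using pos
      by (auto simp: zero_less_mult_iff zero_less_divide_iff mult_less_0_iff)
    then have "sgn (of_real ((v - s) * (q - s) / (v - q)) :: complex) = 1"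
      by (metis of_real_1 sgn_of_real sgn_pos)
    ultimately show "unit_tangent H s = sgn (sdiff V P * sdiff Q P / sdiff V Q)"
      unfolding 1 by (simp only: sgn_mult mult_1_right)
  qed
qed

section \<open>The hexagonal lattice\<close>

lemma eps_power2: "\<epsilon>\<^sup>2 = \<epsilon> - 1"
  by (simp add: \<epsilon>_def complex_eq_iff power2_eq_square cos_60 sin_60)

lemma eps_powers: "\<epsilon> ^ 3 = - 1" "\<epsilon> ^ 4 = - \<epsilon>" "\<epsilon> ^ 5 = 1 - \<epsilon>" "\<epsilon> ^ 6 = 1"
  using eps_power2 by algebra+

lemma eps_shift:
  "\<epsilon> ^ (k + 1) = \<epsilon> ^ k * \<epsilon>" "\<epsilon> ^ (k + 2) = \<epsilon> ^ k * (\<epsilon> - 1)" "\<epsilon> ^ (k + 3) = - (\<epsilon> ^ k)"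
  "\<epsilon> ^ (k + 4) = - (\<epsilon> ^ k * \<epsilon>)" "\<epsilon> ^ (k + 5) = \<epsilon> ^ k * (1 - \<epsilon>)" "\<epsilon> ^ (k + 6) = \<epsilon> ^ k"
  "\<epsilon> ^ (k + 7) = \<epsilon> ^ k * \<epsilon>"
proof -
  have "\<epsilon> ^ 7 = \<epsilon>" using eps_power2 by algebra
  then show "\<epsilon> ^ (k + 7) = \<epsilon> ^ k * \<epsilon>" by (simp only: power_add)
qed (simp_all only: power_add eps_powers eps_power2 power_one_right mult_minus_right mult_1_right)

lemma omega_eq: "\<omega> = \<epsilon> - 1" "\<omega>\<^sup>2 = - \<epsilon>"
proof -
  have "\<omega> = \<epsilon>\<^sup>2" by (simp add: \<omega>_def \<epsilon>_def Complex.DeMoivre)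
  then show "\<omega> = \<epsilon> - 1" using eps_power2 by simp
  then show "\<omega>\<^sup>2 = - \<epsilon>" using eps_power2 by algebra
qed

text \<open>The line spanned by \<open>\<epsilon> ^ k\<close> depends only on \<open>k\<close> modulo 3, since \<open>\<epsilon> ^ 3 = - 1\<close>, and it
determines this residue. This is what turns a class of parallel edges into a residue class
of indices.\<close>

lemma eps_power_eq_up_to_sign:
  fixes f :: "nat \<Rightarrow> 'a"
  assumes "\<And>k. f (k + 3) = f k" and eq: "\<epsilon> ^ j \<in> {u, - u}" "\<epsilon> ^ k \<in> {u, - u}"
  shows "f j = f k"
proof -
  have rep: "\<exists>i\<in>{0,1,2}. f k = f i \<and> (\<epsilon> ^ k = \<epsilon> ^ i \<or> \<epsilon> ^ k = - (\<epsilon> ^ i))" for k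
  proof (induction k rule: less_induct)
    case (less k)
    show ?case
    proof (cases "k < 3")
      case True
      then have "k \<in> {0,1,2}" by auto
      then show ?thesis by blast
    next
      case False
      define m where "m = k - 3"
      have k: "k = m + 3" using False by (simp add: m_def)
      then show ?thesis using less[of m] unfolding k eps_shift assms(1) by fastforce
    qed
  qed
  have "Re \<epsilon> = 1 / 2" "Im \<epsilon> \<noteq> 0" by (simp_all add: \<epsilon>_def cos_60 sin_60)
  then have inj: "i = i'" if "i \<in> {0,1,2}" "i' \<in> {0,1,2}" "\<epsilon> ^ i = \<epsilon> ^ i' \<or> \<epsilon> ^ i = - (\<epsilon> ^ i')" for i i' :: nat
    using that by (auto simp: eps_power2 complex_eq_iff)
  obtain i where i: "i \<in> {0,1,2}" "f j = f i" "\<epsilon> ^ j = \<epsilon> ^ i \<or> \<epsilon> ^ j = - (\<epsilon> ^ i)" using rep by blast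
  obtain i' where i': "i' \<in> {0,1,2}" "f k = f i'" "\<epsilon> ^ k = \<epsilon> ^ i' \<or> \<epsilon> ^ k = - (\<epsilon> ^ i')" using rep by blast
  have "\<epsilon> ^ i = \<epsilon> ^ i' \<or> \<epsilon> ^ i = - (\<epsilon> ^ i')" using i(3) i'(3) eq by (auto, (metis minus_minus)+)
  then show ?thesis using inj i i' by metis
qed

lemma eps_powers_omega:
  "\<epsilon> ^ (1 + 2) = - 1" "\<epsilon> ^ (2 + 2) = \<omega>\<^sup>2" "\<epsilon> ^ (3 + 2) = - \<omega>"
proof -
  have "(1::nat) + 2 = 3" "(2::nat) + 2 = 4" "(3::nat) + 2 = 5" by simp_all
  then show "\<epsilon> ^ (1 + 2) = - 1" "\<epsilon> ^ (2 + 2) = \<omega>\<^sup>2" "\<epsilon> ^ (3 + 2) = - \<omega>"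
    unfolding omega_eq(2) by (simp_all only: eps_powers omega_eq(1) minus_diff_eq)
qed

lemma edge_direction: "(z + \<epsilon> ^ (k + 1)) - (z + \<epsilon> ^ k) = \<epsilon> ^ (k + 2)"
  unfolding eps_shift by (simp add: algebra_simps)

lemma corner_periodic: "corner w z (k + 6) = corner w z k"
  by (simp add: corner_def power_add eps_powers)

lemma petal_periodic: "petal z (k + 6) = petal z k"
  using eps_shift(6)[of k] eps_shift(6)[of "k + 1"] by (simp add: petal_def)

text \<open>The petal \<open>k\<close> shares the corners \<open>k\<close> and \<open>k + 1\<close> with the central hexagon, but runs
through them in the opposite order, as its corners \<open>k + 4\<close> and \<open>k + 3\<close>. The corner \<open>k + 5\<close>
of this petal is the third neighbour of the central corner \<open>k\<close> in the hexagonal lattice; it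
is shared with the preceding petal, whose index is written \<open>k + 5\<close> to avoid subtraction.\<close>

lemma petal_corner:
  "corner w (petal z k) (k + 4) = corner w z k"
  "corner w (petal z k) (k + 3) = corner w z (k + 1)"
  "corner w (petal z k) (k + 5) = corner w (petal z (k + 5)) (k + 7)"
proof -
  have "z + \<epsilon> ^ k + \<epsilon> ^ (k + 1) + \<epsilon> ^ (k + 4) = z + \<epsilon> ^ k"
    unfolding eps_shift by simp
  then show "corner w (petal z k) (k + 4) = corner w z k"
    unfolding corner_def petal_def by (rule arg_cong)
  have "z + \<epsilon> ^ k + \<epsilon> ^ (k + 1) + \<epsilon> ^ (k + 3) = z + \<epsilon> ^ (k + 1)"
    unfolding eps_shift by simp
  then show "corner w (petal z k) (k + 3) = corner w z (k + 1)"
    unfolding corner_def petal_def by (rule arg_cong)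
  have *: "k + 5 + 1 = k + 6" by simp
  have "z + \<epsilon> ^ k + \<epsilon> ^ (k + 1) + \<epsilon> ^ (k + 5) = z + \<epsilon> ^ (k + 5) + \<epsilon> ^ (k + 5 + 1) + \<epsilon> ^ (k + 7)"
    unfolding * eps_shift by (simp add: algebra_simps)
  then show "corner w (petal z k) (k + 5) = corner w (petal z (k + 5)) (k + 7)"
    unfolding corner_def petal_def by (rule arg_cong)
qed

lemma petal_petal:
  "petal (petal z k) (k + 3) = z"
  "petal (petal z k) (k + 4) = petal z (k + 5)"
  "petal (petal z k) (k + 2) = petal z (k + 1)"
proof -
  have *: "k + 2 + 1 = k + 3" "k + 1 + 1 = k + 2" "k + 3 + 1 = k + 4" "k + 4 + 1 = k + 5" "k + 5 + 1 = k + 6"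
    by simp_all
  show "petal (petal z k) (k + 3) = z"
    unfolding petal_def * eps_shift by simp
  show "petal (petal z k) (k + 2) = petal z (k + 1)"
    unfolding petal_def * eps_shift by (simp add: algebra_simps)
  show "petal (petal z k) (k + 4) = petal z (k + 5)"
    unfolding petal_def * eps_shift by (simp add: algebra_simps)
qed

text \<open>The faces form the lattice spanned by two neighbouring translations to a petal, so
that invariance under these translations will mean independence of the face.\<close>

lemma hex_faces_iff:
  "z \<in> hex_faces \<longleftrightarrow> (\<exists>i j :: int. z = of_int i * (1 + \<epsilon>) + of_int j * (\<epsilon> + \<epsilon>\<^sup>2))"
proof
  assume "z \<in> hex_faces"
  then obtain k l m :: int where z: "z = of_int k + of_int l * \<omega> + of_int m * \<omega>\<^sup>2"
    and "(k + l + m) mod 3 = 0" by (auto simp: hex_faces_def)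
  then obtain n where n: "k + l + m = 3 * n" by (metis mod_0_imp_dvd dvd_def)
  then have m: "m = 3 * n - k - l" by simp
  have "\<epsilon>\<^sup>2 = \<epsilon> - 1" by (rule eps_power2)
  then have "z = of_int (k - n) * (1 + \<epsilon>) + of_int (l - n) * (\<epsilon> + \<epsilon>\<^sup>2)"
    unfolding z omega_eq m of_int_diff of_int_mult of_int_numeral by algebra
  then show "\<exists>i j :: int. z = of_int i * (1 + \<epsilon>) + of_int j * (\<epsilon> + \<epsilon>\<^sup>2)" by blast
next
  assume "\<exists>i j :: int. z = of_int i * (1 + \<epsilon>) + of_int j * (\<epsilon> + \<epsilon>\<^sup>2)"
  then obtain i j :: int where z: "z = of_int i * (1 + \<epsilon>) + of_int j * (\<epsilon> + \<epsilon>\<^sup>2)" by blast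
  have "z = of_int i + of_int j * \<omega> + of_int (- i - j) * \<omega>\<^sup>2"
    unfolding z omega_eq of_int_diff of_int_minus using eps_power2 by algebra
  moreover have "(i + j + (- i - j)) mod 3 = 0" by simp
  ultimately show "z \<in> hex_faces" unfolding hex_faces_def by (intro CollectI exI conjI)
qed

lemma petal_in_faces:
  assumes "z \<in> hex_faces" shows "petal z k \<in> hex_faces"
proof -
  obtain i j :: int where z: "z = of_int i * (1 + \<epsilon>) + of_int j * (\<epsilon> + \<epsilon>\<^sup>2)"
    using assms hex_faces_iff by blast
  have "\<exists>m n :: int. \<epsilon> ^ k + \<epsilon> ^ (k + 1) = of_int m * (1 + \<epsilon>) + of_int n * (\<epsilon> + \<epsilon>\<^sup>2)"
  proof (induction k)
    case 0
    have "\<epsilon> ^ 0 + \<epsilon> ^ (0 + 1) = of_int 1 * (1 + \<epsilon>) + of_int 0 * (\<epsilon> + \<epsilon>\<^sup>2)" by simp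
    then show ?case by blast
  next
    case (Suc k)
    then obtain m n :: int
      where "\<epsilon> ^ k + \<epsilon> ^ (k + 1) = of_int m * (1 + \<epsilon>) + of_int n * (\<epsilon> + \<epsilon>\<^sup>2)" by blast
    then have "\<epsilon> * (\<epsilon> ^ k + \<epsilon> ^ (k + 1)) = \<epsilon> * (of_int m * (1 + \<epsilon>) + of_int n * (\<epsilon> + \<epsilon>\<^sup>2))" by simp
    also have "\<dots> = of_int (- n) * (1 + \<epsilon>) + of_int (m + n) * (\<epsilon> + \<epsilon>\<^sup>2)"
      unfolding of_int_minus of_int_add using eps_power2 by algebra
    finally show ?case by (metis (no_types, lifting) add_Suc distrib_left power_Suc)
  qed
  then obtain m n :: int
    where "\<epsilon> ^ k + \<epsilon> ^ (k + 1) = of_int m * (1 + \<epsilon>) + of_int n * (\<epsilon> + \<epsilon>\<^sup>2)" by blast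
  then have "petal z k = of_int (i + m) * (1 + \<epsilon>) + of_int (j + n) * (\<epsilon> + \<epsilon>\<^sup>2)"
    by (simp add: petal_def z algebra_simps)
  then show ?thesis using hex_faces_iff by blast
qed

section \<open>Intersection angles as arguments of cross-ratios\<close>

text \<open>Both tangents at \<open>p\<close> are read off from the other common point \<open>q\<close> and one further
point on each circle. The two circles pass through \<open>p\<close> and \<open>q\<close> in opposite orders, and the
sign that this produces cancels the one in front of the quotient. The Moebius map \<open>S\<close>
disappears since the cross-ratio is invariant.\<close>

lemma tangent_quotient:
  assumes "moebius G'" "moebius G''" "moebius S" "S p \<noteq> None"
    and p: "G' (Some (of_real s')) = p" "G'' (Some (of_real s'')) = p"
    and cyc: "cyclic_on G' p q v" "cyclic_on G'' q p r"
  shows "- unit_tangent (S \<circ> G'') s'' / unit_tangent (S \<circ> G') s' = sgn (cross_ratio p q r v)"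
proof -
  have c: "cyclic_on (S \<circ> G') (S p) (S q) (S v)" "cyclic_on (S \<circ> G'') (S p) (S r) (S q)"
    using cyc(1) cyclic_on_rotate[OF cyc(2)] unfolding cyclic_on_def by (metis comp_apply)+
  have m: "moebius (S \<circ> G')" "moebius (S \<circ> G'')" using assms moebius_compose by auto
  obtain t' where t': "S p = (S \<circ> G') (Some (of_real t'))"
    "unit_tangent (S \<circ> G') t' = sgn (sdiff (S v) (S p) * sdiff (S q) (S p) / sdiff (S v) (S q))"
    using unit_tangent_eq[OF m(1) c(1)] assms(4) by metis
  obtain t'' where t'': "S p = (S \<circ> G'') (Some (of_real t''))"
    "unit_tangent (S \<circ> G'') t'' = sgn (sdiff (S q) (S p) * sdiff (S r) (S p) / sdiff (S q) (S r))"
    using unit_tangent_eq[OF m(2) c(2)] assms(4) by metis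
  have s: "s' = t'" "s'' = t''"
    using t'(1) t''(1) p moebius_inj assms(1-3) by (metis comp_apply of_real_eq_iff option.inject)+
  have "sdiff (S q) (S p) \<noteq> 0" "sdiff (S v) (S p) \<noteq> 0" "sdiff (S v) (S q) \<noteq> 0"
    using cyclic_on_distinct[OF m(1) c(1)] by (auto simp: sdiff_eq_0_iff)
  moreover have "sdiff (S q) (S r) = - sdiff (S r) (S q)" by (rule sdiff_swap)
  ultimately have *: "sdiff (S q) (S p) * sdiff (S r) (S p) / sdiff (S q) (S r) =
      - (cross_ratio (S p) (S q) (S r) (S v) * (sdiff (S v) (S p) * sdiff (S q) (S p) / sdiff (S v) (S q)))"
    unfolding cross_ratio_def by simp
  have "sgn (sdiff (S v) (S p) * sdiff (S q) (S p) / sdiff (S v) (S q)) \<noteq> 0"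
    using \<open>sdiff (S q) (S p) \<noteq> 0\<close> \<open>sdiff (S v) (S p) \<noteq> 0\<close> \<open>sdiff (S v) (S q) \<noteq> 0\<close> by (simp add: sgn_eq_0_iff)
  then show ?thesis
    unfolding s t'(2) t''(2) * sgn_minus sgn_mult[of "cross_ratio _ _ _ _"] minus_minus
      moebius_cross_ratio[OF assms(3)] by (rule nonzero_mult_div_cancel_right)
qed

lemma sgn_eq_cis_Arg2pi: "x \<noteq> 0 \<Longrightarrow> sgn x = cis (Arg2pi x)"
  using Arg2pi_eq[of x] by (simp add: sgn_eq cis_conv_exp field_simps)

text \<open>The key to all that follows: although an intersection angle is defined by derivatives
and by a choice of parametrisations, it is the argument of a cross-ratio of four vertices of
the pattern. The third vertex can be any further corner of the petal, the fourth any further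
corner of the central hexagon; different uses below need different choices.\<close>

lemma intersection_angle_eq:
  assumes w: "hexagonal_circle_pattern w" and z: "z \<in> hex_faces"
    and ij: "2 \<le> i" "i \<le> 5" "5 \<le> j" "j \<le> 8"
  shows "intersection_angle w z k =
    Arg2pi (cross_ratio (corner w z k) (corner w z (k + 1)) (corner w (petal z k) (k + j)) (corner w z (k + i)))"
    (is "_ = Arg2pi ?X")
  unfolding intersection_angle_def
proof (rule the_equality)
  let ?p = "corner w z k"
  have cyc': "cyclic_on G ?p (corner w z (k + 1)) (corner w z (k + i))"
    if "runs_through G (corner w z)" for G
    using ij by (intro runs_through_cyclic[OF that corner_periodic]) auto
  have cyc'': "cyclic_on G (corner w z (k + 1)) ?p (corner w (petal z k) (k + j))"
    if "runs_through G (corner w (petal z k))" for G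
    unfolding petal_corner[of w z k, symmetric]
    using ij by (intro runs_through_cyclic[OF that corner_periodic]) auto
  have moe: "moebius G" if "runs_through G p" for G p using that by (simp add: runs_through_def)
  obtain G' G'' where G: "runs_through G' (corner w z)" "runs_through G'' (corner w (petal z k))"
    using w z petal_in_faces unfolding hexagonal_circle_pattern_def by meson
  obtain s' where s': "G' (Some (of_real s')) = ?p"
    using cyc'[OF G(1)] unfolding cyclic_on_def by metis
  obtain s'' where s'': "G'' (Some (of_real s'')) = ?p"
    using cyc''[OF G(2)] unfolding cyclic_on_def by metis
  obtain S where S: "moebius S" "S ?p \<noteq> None" using moebius_finite_at by blast
  have "?X \<noteq> 0"
    using cyclic_on_distinct[OF moe[OF G(1)] cyc'[OF G(1)]] cyclic_on_distinct[OF moe[OF G(2)] cyc''[OF G(2)]]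
    by (intro cross_ratio_nonzero) auto
  then have X: "sgn ?X = cis (Arg2pi ?X)" by (rule sgn_eq_cis_Arg2pi)
  have "cis (Arg2pi ?X) = - unit_tangent (S \<circ> G'') s'' / unit_tangent (S \<circ> G') s'"
    using tangent_quotient[OF moe[OF G(1)] moe[OF G(2)] S s' s'' cyc'[OF G(1)] cyc''[OF G(2)]] X by simp
  then show "0 \<le> Arg2pi ?X \<and> Arg2pi ?X < 2 * pi \<and> (\<exists>S G' G'' s' s''. moebius S \<and> S ?p \<noteq> None \<and>
        runs_through G' (corner w z) \<and> G' (Some (of_real s')) = ?p \<and>
        runs_through G'' (corner w (petal z k)) \<and> G'' (Some (of_real s'')) = ?p \<and>
        cis (Arg2pi ?X) = - unit_tangent (S \<circ> G'') s'' / unit_tangent (S \<circ> G') s')"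
    using S G s' s'' Arg2pi[of ?X] by blast
  fix \<phi>
  assume \<phi>: "0 \<le> \<phi> \<and> \<phi> < 2 * pi \<and> (\<exists>S G' G'' s' s''. moebius S \<and> S ?p \<noteq> None \<and>
        runs_through G' (corner w z) \<and> G' (Some (of_real s')) = ?p \<and>
        runs_through G'' (corner w (petal z k)) \<and> G'' (Some (of_real s'')) = ?p \<and>
        cis \<phi> = - unit_tangent (S \<circ> G'') s'' / unit_tangent (S \<circ> G') s')"
  then obtain S G' G'' s' s'' where S: "moebius S" "S ?p \<noteq> None"
    and G: "runs_through G' (corner w z)" "runs_through G'' (corner w (petal z k))"
    and s: "G' (Some (of_real s')) = ?p" "G'' (Some (of_real s'')) = ?p"
    and eq: "cis \<phi> = - unit_tangent (S \<circ> G'') s'' / unit_tangent (S \<circ> G') s'"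
    by blast
  have "cis \<phi> = sgn ?X"
    unfolding eq by (rule tangent_quotient[OF moe[OF G(1)] moe[OF G(2)] S s cyc'[OF G(1)] cyc''[OF G(2)]])
  then have "complex_of_real (cmod ?X) * exp (\<i> * complex_of_real \<phi>) = ?X"
    using \<open>?X \<noteq> 0\<close> by (simp add: cis_conv_exp sgn_eq)
  then show "\<phi> = Arg2pi ?X" using Arg2pi_unique \<phi> \<open>?X \<noteq> 0\<close> by (metis zero_less_norm_iff)
qed

section \<open>The circles of a flower\<close>

lemma corner_distinct:
  assumes "hexagonal_circle_pattern w" "z \<in> hex_faces" "i < j" "j < i + 6"
  shows "corner w z i \<noteq> corner w z j"
proof -
  obtain G where G: "runs_through G (corner w z)"
    using assms unfolding hexagonal_circle_pattern_def by blast
  then have m: "moebius G" by (simp add: runs_through_def)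
  note cyc = runs_through_cyclic[OF G corner_periodic]
  show ?thesis
  proof (cases "j = i + 5")
    case True
    then show ?thesis using cyclic_on_distinct(3)[OF m cyc[of i "i + 1" j]] assms by simp
  next
    case False
    then show ?thesis using cyclic_on_distinct(1)[OF m cyc[of i j "i + 5"]] assms by simp
  qed
qed

lemma circle_at_props:
  assumes "hexagonal_circle_pattern w" "z \<in> hex_faces"
  shows circle_at_is_circle: "is_circle (circle_at w z)"
    and corner_in_circle_at: "corner w z k \<in> circle_at w z"
proof -
  obtain G where G: "runs_through G (corner w z)"
    using assms unfolding hexagonal_circle_pattern_def by blast
  have "circle_at w z = G ` extended_reals" unfolding circle_at_def
  proof (rule the_equality)
    show *: "is_circle (G ` extended_reals) \<and> (\<forall>k\<in>{1..6}. corner w z k \<in> G ` extended_reals)"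
      using G unfolding runs_through_def is_circle_def extended_reals_def by blast
    show "C = G ` extended_reals" if "is_circle C \<and> (\<forall>k\<in>{1..6}. corner w z k \<in> C)" for C
      using that * corner_distinct[OF assms]
      by (intro circle_unique[of C "corner w z 1" "corner w z 2" "corner w z 3"]) auto
  qed
  then show 1: "is_circle (circle_at w z)"
    using G unfolding is_circle_def runs_through_def by blast
  show "corner w z k \<in> circle_at w z"
  proof (rule periodic_all)
    show "corner w z k \<in> circle_at w z" if "k \<in> {1..6}" for k
      using that G unfolding \<open>circle_at w z = G ` extended_reals\<close> runs_through_def extended_reals_def by blast
  qed (simp add: corner_periodic)
qed

lemma circle_atI:
  assumes "hexagonal_circle_pattern w" "z \<in> hex_faces" "is_circle C"
    "i < j" "j < l" "l < i + 6" "corner w z i \<in> C" "corner w z j \<in> C" "corner w z l \<in> C"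
  shows "C = circle_at w z"
  using assms circle_at_props[OF assms(1,2)] corner_distinct[OF assms(1,2)]
  by (intro circle_unique[of C "corner w z i" "corner w z j" "corner w z l"]) auto

lemma intersection_angle_periodic: "intersection_angle w z (k + 6) = intersection_angle w z k"
  unfolding intersection_angle_def corner_periodic petal_periodic ..

context
  fixes w z
  assumes w: "hexagonal_circle_pattern w" and z: "z \<in> hex_faces"
begin

lemma petal_face: "petal z k \<in> hex_faces"
  using z by (rule petal_in_faces)

lemma corners_in_petal_circle:
  "corner w z k \<in> circle_at w (petal z k)"
  "corner w z (k + 1) \<in> circle_at w (petal z k)"
  "corner w (petal z k) (k + 5) \<in> circle_at w (petal z k)"
  "corner w (petal z k) (k + 5) \<in> circle_at w (petal z (k + 5))"
  "corner w z k \<in> circle_at w (petal z (k + 5))"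
proof -
  note in_circle = corner_in_circle_at[OF w petal_face]
  show "corner w z k \<in> circle_at w (petal z k)"
    using in_circle[of k "k + 4"] unfolding petal_corner .
  show "corner w z (k + 1) \<in> circle_at w (petal z k)"
    using in_circle[of k "k + 3"] unfolding petal_corner .
  show "corner w (petal z k) (k + 5) \<in> circle_at w (petal z k)"
    by (rule in_circle)
  show "corner w (petal z k) (k + 5) \<in> circle_at w (petal z (k + 5))"
    unfolding petal_corner by (rule in_circle)
  have "k + 5 + 1 = k + 6" by simp
  then show "corner w z k \<in> circle_at w (petal z (k + 5))"
    using in_circle[of "k + 5" "k + 5 + 3"] unfolding petal_corner by (simp only: corner_periodic)
qed

lemma outer_corner_distinct:
  "corner w (petal z k) (k + 5) \<noteq> corner w z k"
  "corner w (petal z k) (k + 5) \<noteq> corner w z (k + 1)"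
  using corner_distinct[OF w petal_face, of "k + 4" "k + 5" k]
    corner_distinct[OF w petal_face, of "k + 3" "k + 5" k]
  unfolding petal_corner(1,2) by auto

lemma proper_flower_petal:
  assumes "proper_flower w z"
  shows "circle_at w (petal z k) \<noteq> circle_at w z"
proof (rule periodic_all)
  show "circle_at w (petal z k) \<noteq> circle_at w z" if "k \<in> {1..6}" for k
    using that assms by (simp add: proper_flower_def)
qed (simp add: petal_periodic)

text \<open>Two different circles share at most two points. So in a proper flower the circles
determine the corners of the central hexagon.\<close>

lemma centre_meets_petal:
  assumes "proper_flower w z"
  shows "circle_at w z \<inter> circle_at w (petal z k) = {corner w z k, corner w z (k + 1)}"
proof -
  have "x \<in> {corner w z k, corner w z (k + 1)}"
    if "x \<in> circle_at w z" "x \<in> circle_at w (petal z k)" for x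
  proof (rule ccontr)
    assume "x \<notin> {corner w z k, corner w z (k + 1)}"
    then have "circle_at w (petal z k) = circle_at w z"
      using that corner_distinct[OF w z, of k "k + 1"] corners_in_petal_circle(1,2)
        circle_at_props[OF w] z petal_face
      by (intro circle_unique[of _ "corner w z k" "corner w z (k + 1)" x]) auto
    then show False using proper_flower_petal[OF assms] by simp
  qed
  then show ?thesis
    using corners_in_petal_circle(1,2) corner_in_circle_at[OF w z] by auto
qed

text \<open>If two neighbouring petals were on one circle, it would contain three corners of the
central hexagon and coincide with the central circle.\<close>

lemma petal_meets_petal:
  assumes "proper_flower w z"
  shows "circle_at w (petal z k) \<inter> circle_at w (petal z (k + 5)) =
    {corner w z k, corner w (petal z k) (k + 5)}"
proof -
  let ?r = "corner w (petal z k) (k + 5)"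
  have ne: "circle_at w (petal z k) \<noteq> circle_at w (petal z (k + 5))"
  proof
    assume "circle_at w (petal z k) = circle_at w (petal z (k + 5))"
    then have "corner w z (k + 5) \<in> circle_at w (petal z k)"
      using corners_in_petal_circle(1) by simp
    then have "corner w z (k + 5) \<in> {corner w z k, corner w z (k + 1)}"
      using centre_meets_petal[OF assms] corner_in_circle_at[OF w z] by blast
    then show False
      using corner_distinct[OF w z, of k "k + 5"] corner_distinct[OF w z, of "k + 1" "k + 5"] by auto
  qed
  have "x \<in> {corner w z k, ?r}"
    if "x \<in> circle_at w (petal z k)" "x \<in> circle_at w (petal z (k + 5))" for x
  proof (rule ccontr)
    assume "x \<notin> {corner w z k, ?r}"
    then have d: "corner w z k \<noteq> ?r" "corner w z k \<noteq> x" "?r \<noteq> x"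
      using outer_corner_distinct(1)[of k] by auto
    have "circle_at w (petal z k) = circle_at w (petal z (k + 5))"
      by (rule circle_unique[OF circle_at_is_circle[OF w petal_face] corners_in_petal_circle(1,3) that(1)
            circle_at_is_circle[OF w petal_face] corners_in_petal_circle(5,4) that(2) d])
    then show False using ne by simp
  qed
  then show ?thesis using corners_in_petal_circle by auto
qed

lemma angle_eq:
  "intersection_angle w z k = Arg2pi (cross_ratio (corner w z k) (corner w z (k + 1))
     (corner w (petal z k) (k + 5)) (corner w z (k + 2)))"
  by (rule intersection_angle_eq[OF w z]) auto

section \<open>Conformally symmetric flowers\<close>

text \<open>Among the six factors of the multi-ratio of increasing real numbers, only the
difference of the last and the first one is positive.\<close>

lemma multi_ratio_corner_real_negative:
  obtains m :: real where "m < 0" "corner_multi_ratio w z = of_real m"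
proof -
  obtain G where G: "runs_through G (corner w z)"
    using w z unfolding hexagonal_circle_pattern_def by blast
  then obtain t where t: "moebius G" "strict_mono_on {1..6} t"
      "\<And>k. k \<in> {1..6} \<Longrightarrow> corner w z k = G (Some (of_real (t k)))"
    unfolding runs_through_def by blast
  have lt: "t 1 < t 2" "t 2 < t 3" "t 3 < t 4" "t 4 < t 5" "t 5 < t 6"
    using t(2) by (auto simp: strict_mono_on_def)
  define m where "m = (t 1 - t 2) / (t 2 - t 3) * ((t 3 - t 4) / (t 4 - t 5)) * ((t 5 - t 6) / (t 6 - t 1))"
  have "0 < (t 1 - t 2) / (t 2 - t 3)" "0 < (t 3 - t 4) / (t 4 - t 5)"
    using lt by (auto intro: divide_neg_neg)
  moreover have "(t 5 - t 6) / (t 6 - t 1) < 0"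
    using lt by (intro divide_neg_pos) auto
  ultimately have "m < 0" unfolding m_def by (intro mult_pos_neg mult_pos_pos)
  moreover have "corner_multi_ratio w z = of_real m"
    by (simp add: corner_multi_ratio_def t(3) moebius_multi_ratio[OF t(1)]) (simp add: multi_ratio_def m_def)
  ultimately show ?thesis using that by blast
qed

text \<open>A symmetry permutes the circles of the flower, hence also their intersection points,
so it sends each corner to the opposite corner, and likewise the outer intersection points
of neighbouring petals. Angles are cross-ratios of such points, so opposite ones agree.
Applied to the multi-ratio, the symmetry shifts the six points by three, which inverts the
multi-ratio; it is therefore 1 or -1, and it is negative.\<close>

lemma symmetric_flowerD:
  assumes proper: "proper_flower w z" and sym: "conformally_symmetric_flower w z"
  shows "intersection_angle w z (k + 3) = intersection_angle w z k"
    and "corner_multi_ratio w z = - 1"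
proof -
  obtain T where sym': "moebius_involution T \<and> T ` circle_at w z = circle_at w z \<and>
     (\<forall>k\<in>{1..6}. T ` circle_at w (petal z k) = circle_at w (petal z (k + 3)))"
    using sym unfolding conformally_symmetric_flower_def by (rule exE)
  then have T: "moebius T" "T ` circle_at w z = circle_at w z"
    "\<And>k. k \<in> {1..6} \<Longrightarrow> T ` circle_at w (petal z k) = circle_at w (petal z (k + 3))"
    by (simp_all add: moebius_involution_def)
  note inj = moebius_inj[OF T(1)]
  then have "inj T" by (simp add: inj_def)
  then have im: "T ` (A \<inter> B) = T ` A \<inter> T ` B" for A B by (rule image_Int)
  have shift: "k + 3 + 5 = k + 5 + 3" "k + 5 + 1 + 3 = k + 3 + 6" "k + 5 + 1 = k + 6"  "k + 6 + 3 = k + 3 + 6" for k :: nat by auto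
  have petals: "T ` circle_at w (petal z k) = circle_at w (petal z (k + 3))" for k
  proof (rule periodic_all[where P = "\<lambda>k. T ` circle_at w (petal z k) = circle_at w (petal z (k + 3))"])
    show "T ` circle_at w (petal z (k + 6)) = circle_at w (petal z (k + 6 + 3)) \<longleftrightarrow>
      T ` circle_at w (petal z k) = circle_at w (petal z (k + 3))" for k
      by (simp only: shift petal_periodic)
  qed (rule T(3))
  have edge: "{T (corner w z k), T (corner w z (k + 1))} = {corner w z (k + 3), corner w z (k + 3 + 1)}" for k
  proof -
    have "T ` (circle_at w z \<inter> circle_at w (petal z k)) = circle_at w z \<inter> circle_at w (petal z (k + 3))"
      by (simp only: im T(2) petals)
    then show ?thesis unfolding centre_meets_petal[OF proper] image_insert image_empty .
  qed
  have corners: "T (corner w z k) = corner w z (k + 3)" for k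
  proof -
    \<comment> \<open>a corner is the common point of its two edges, and \<open>T\<close> shifts edges by 3\<close>
    have step: "T (corner w z (k + 1)) = corner w z (k + 4)" for k
    proof -
      have e: "k + 3 + 1 = k + 4" "k + 1 + 3 = k + 4" "k + 1 + 3 + 1 = k + 5" "k + 4 + 1 = k + 5" by simp_all
      have "T (corner w z (k + 1)) \<in> {corner w z (k + 3), corner w z (k + 4)}"
        using edge[of k] unfolding e by blast
      moreover have "T (corner w z (k + 1)) \<in> {corner w z (k + 4), corner w z (k + 5)}"
        using edge[of "k + 1"] unfolding e by blast
      moreover have "corner w z (k + 3) \<noteq> corner w z (k + 5)"
        using corner_distinct[OF w z, of "k + 3" "k + 5"] by auto
      ultimately show ?thesis by auto
    qed
    have "k + 5 + 1 = k + 6" "k + 5 + 4 = k + 3 + 6" by simp_all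
    then show ?thesis using step[of "k + 5"] by (simp only: corner_periodic)
  qed
  have outer: "T (corner w (petal z k) (k + 5)) = corner w (petal z (k + 3)) (k + 3 + 5)" for k
  proof -
    have "T ` (circle_at w (petal z k) \<inter> circle_at w (petal z (k + 5))) =
      circle_at w (petal z (k + 3)) \<inter> circle_at w (petal z (k + 3 + 5))"
      by (simp only: im petals shift)
    then have "{corner w z (k + 3), T (corner w (petal z k) (k + 5))} =
        {corner w z (k + 3), corner w (petal z (k + 3)) (k + 3 + 5)}"
      unfolding petal_meets_petal[OF proper] by (simp add: corners)
    moreover have "corner w z (k + 3) \<noteq> T (corner w (petal z k) (k + 5))"
      using outer_corner_distinct(1)[of k] by (simp add: corners[symmetric] inj)
    ultimately show ?thesis by (auto simp: doubleton_eq_iff)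
  qed
  have "cross_ratio (corner w z (k + 3)) (corner w z (k + 3 + 1)) (corner w (petal z (k + 3)) (k + 3 + 5)) (corner w z (k + 3 + 2))
    = cross_ratio (corner w z k) (corner w z (k + 1)) (corner w (petal z k) (k + 5)) (corner w z (k + 2))"
  proof -
    have "k + 3 + 1 = k + 1 + 3" "k + 3 + 2 = k + 2 + 3" by auto
    then show ?thesis by (simp only: corners[symmetric] outer[symmetric] moebius_cross_ratio[OF T(1)])
  qed
  then show "intersection_angle w z (k + 3) = intersection_angle w z k"
    unfolding angle_eq by (rule arg_cong)
  define p where "p = corner w z"
  have p: "T (p 1) = p 4" "T (p 2) = p 5" "T (p 3) = p 6" "T (p 4) = p 1" "T (p 5) = p 2" "T (p 6) = p 3"
    using corners[of 1] corners[of 2] corners[of 3] corners[of 4] corners[of 5] corners[of 6]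
      corner_periodic[of w z 1] corner_periodic[of w z 2] corner_periodic[of w z 3] by (auto simp: p_def)
  have m: "corner_multi_ratio w z = multi_ratio (p 1) (p 2) (p 3) (p 4) (p 5) (p 6)"
    by (simp add: corner_multi_ratio_def p_def)
  also have "\<dots> = multi_ratio (p 4) (p 5) (p 6) (p 1) (p 2) (p 3)"
    using moebius_multi_ratio[OF T(1), of "p 1" "p 2" "p 3" "p 4" "p 5" "p 6"] unfolding p by (rule HOL.sym)
  also have "\<dots> = 1 / corner_multi_ratio w z"
    unfolding m multi_ratio_def by (simp add: divide_simps)
  finally have "corner_multi_ratio w z = 1 / corner_multi_ratio w z" .
  moreover obtain m :: real where "m < 0" "corner_multi_ratio w z = of_real m"
    by (rule multi_ratio_corner_real_negative)
  ultimately have "of_real (m * m) = (1 :: complex)" by (metis less_irrefl mult.commute nonzero_eq_divide_eq of_real_eq_0_iff of_real_mult)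
  then have "m * m = 1" using of_real_eq_1_iff by blast
  then have "m = - 1" using \<open>m < 0\<close> square_eq_1_iff[of m] by auto
  then show "corner_multi_ratio w z = - 1" using \<open>corner_multi_ratio w z = of_real m\<close> by simp
qed

end

text \<open>A Moebius involution swaps \<open>x\<close> and \<open>y\<close> iff \<open>\<gamma> x y = \<alpha> (x + y) + \<beta>\<close>, a linear condition
on its coefficients. Two pairs determine them up to scaling, which is the choice of \<open>\<alpha>\<close>,
\<open>\<beta>\<close>, \<open>\<gamma>\<close> in the proof. The third pair is swapped as well iff a 3x3 determinant vanishes. Up
to sign this determinant is the polynomial in the assumption; for distinct points its
vanishing means that the multi-ratio of \<open>a\<close>, \<open>b\<close>, \<open>c\<close>, \<open>a'\<close>, \<open>b'\<close>, \<open>c'\<close> is -1.\<close>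

lemma involution_swapping_pairs:
  fixes a b c a' b' c' :: complex
  assumes dist: "a \<noteq> b" "a \<noteq> b'" "a' \<noteq> b" "a' \<noteq> b'"
    and mr: "(a - b) * (c - a') * (b' - c') + (b - c) * (a' - b') * (c' - a) = 0"
    and "a \<noteq> a'"
  obtains T where "moebius_involution T"
    "T (Some a) = Some a'" "T (Some b) = Some b'" "T (Some c) = Some c'"
proof -
  define \<alpha> \<gamma> where "\<alpha> = a * a' - b * b'" and "\<gamma> = a + a' - (b + b')"
  define \<beta> where "\<beta> = \<gamma> * (a * a') - \<alpha> * (a + a')"
  \<comment> \<open>up to sign the determinant of \<open>T\<close>; it is the resultant of the quadratics with roots \<open>a, a'\<close> and \<open>b, b'\<close>\<close>
  define E where "E = \<alpha> * \<alpha> + \<beta> * \<gamma>"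
  have "E = (a - b) * (a - b') * (a' - b) * (a' - b')"
    unfolding E_def \<alpha>_def \<beta>_def \<gamma>_def by algebra
  then have E: "E \<noteq> 0" using dist by simp
  have det: "\<alpha> * (- \<alpha>) - \<beta> * \<gamma> \<noteq> 0"
    using E unfolding E_def by (metis add_uminus_conv_diff minus_add_distrib mult_minus_right neg_equal_0_iff_equal)
  define T where "T = moebius_map \<alpha> \<beta> \<gamma> (- \<alpha>)"
  have swap: "T (Some x) = Some y" if "\<gamma> * x * y = \<alpha> * (x + y) + \<beta>" for x y
  proof -
    have "\<gamma> * x + - \<alpha> \<noteq> 0"
    proof
      assume "\<gamma> * x + - \<alpha> = 0"
      then have "E = 0" using that unfolding E_def by algebra
      then show False using E by simp
    qed
    moreover have "\<alpha> * x + \<beta> = y * (\<gamma> * x + - \<alpha>)" using that by algebra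
    ultimately show ?thesis by (simp add: T_def)
  qed
  have "T (T x) = x" for x
    unfolding T_def moebius_map_compose[OF det det]
    using fun_cong[OF moebius_map_scalar[OF E], of x] unfolding E_def by (simp add: algebra_simps)
  moreover have a: "T (Some a) = Some a'"
    by (rule swap) (unfold \<beta>_def, algebra)
  moreover have "T (Some b) = Some b'"
    by (rule swap) (unfold \<beta>_def \<alpha>_def \<gamma>_def, algebra)
  moreover have "T (Some c) = Some c'"
  proof (rule swap)
    show "\<gamma> * c * c' = \<alpha> * (c + c') + \<beta>"
      using mr unfolding \<beta>_def \<alpha>_def \<gamma>_def by algebra
  qed
  moreover have "moebius T" unfolding moebius_def T_def using det by blast
  moreover have "T \<noteq> id" using a \<open>a \<noteq> a'\<close> by auto
  ultimately show ?thesis using that unfolding moebius_involution_def by (metis comp_apply eq_id_iff)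
qed

lemma moebius_involution_conjugate:
  assumes "moebius_involution T" "moebius G" "moebius H" "\<And>x. H (G x) = x" "\<And>x. G (H x) = x"
  shows "moebius_involution (G \<circ> T \<circ> H)"
proof -
  have "T (T x) = x" for x using assms(1) unfolding moebius_involution_def by (metis comp_apply id_apply)
  then have "(G \<circ> T \<circ> H) \<circ> (G \<circ> T \<circ> H) = id" using assms by (simp add: fun_eq_iff)
  moreover have "G \<circ> T \<circ> H \<noteq> id"
  proof
    assume "G \<circ> T \<circ> H = id"
    then have "T x = x" for x using assms(4,5) by (metis comp_apply id_apply)
    then show False using assms(1) unfolding moebius_involution_def by (auto simp: fun_eq_iff)
  qed
  ultimately show ?thesis
    using assms(1-3) moebius_compose unfolding moebius_involution_def by blast
qed

lemma cross_ratio_quotient: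
  assumes "v \<noteq> p" "v \<noteq> q" "x \<noteq> p" "x \<noteq> q" "r \<noteq> p" "r \<noteq> q"
  shows "cross_ratio p q r x = cross_ratio p q r v / cross_ratio p q x v"
proof -
  have "a * b / (c * d) = (a * e / (c * f)) / (d * e / (b * f))" if "e \<noteq> 0" "f \<noteq> 0"
    for a b c d e f :: complex
    using that by (simp add: divide_simps)
  then show ?thesis using assms by (simp add: cross_ratio_def sdiff_eq_0_iff)
qed

context
  fixes w z
  assumes w: "hexagonal_circle_pattern w" and z: "z \<in> hex_faces"
begin

lemma corner_involution:
  assumes "corner_multi_ratio w z = - 1"
  obtains T where "moebius_involution T" "\<And>k. T (corner w z k) = corner w z (k + 3)"
proof -
  obtain G where G: "runs_through G (corner w z)"
    using w z unfolding hexagonal_circle_pattern_def by blast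
  then obtain t where t: "moebius G" "strict_mono_on {1..6} t"
      "\<And>k. k \<in> {1..6} \<Longrightarrow> corner w z k = G (Some (of_real (t k)))"
    unfolding runs_through_def by blast
  define c where "c k = complex_of_real (t k)" for k
  have c: "corner w z 1 = G (Some (c 1))" "corner w z 2 = G (Some (c 2))" "corner w z 3 = G (Some (c 3))"
    "corner w z 4 = G (Some (c 4))" "corner w z 5 = G (Some (c 5))" "corner w z 6 = G (Some (c 6))"
    by (simp_all add: c_def t(3))
  have lt: "t 1 < t 2" "t 2 < t 3" "t 3 < t 4" "t 4 < t 5" "t 5 < t 6"
    using t(2) by (auto simp: strict_mono_on_def)
  have ne: "c 1 \<noteq> c 2" "c 1 \<noteq> c 5" "c 4 \<noteq> c 2" "c 4 \<noteq> c 5" "c 1 \<noteq> c 4" "c 2 \<noteq> c 3" "c 6 \<noteq> c 1"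
    using lt by (simp_all add: c_def)
  have "(c 1 - c 2) / (c 2 - c 3) * ((c 3 - c 4) / (c 4 - c 5)) * ((c 5 - c 6) / (c 6 - c 1)) = - 1"
    using assms unfolding corner_multi_ratio_def c moebius_multi_ratio[OF t(1)]
    by (simp add: multi_ratio_def)
  then have mr: "(c 1 - c 2) * (c 3 - c 4) * (c 5 - c 6) + (c 2 - c 3) * (c 4 - c 5) * (c 6 - c 1) = 0"
    using ne by (simp add: divide_simps add_eq_0_iff)
  obtain R where R: "moebius_involution R" "R (Some (c 1)) = Some (c 4)" "R (Some (c 2)) = Some (c 5)"
      "R (Some (c 3)) = Some (c 6)"
    by (rule involution_swapping_pairs[OF ne(1-4) mr ne(5)])
  have RR: "R (R x) = x" for x using R(1) unfolding moebius_involution_def by (metis comp_apply id_apply)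
  obtain H where H: "moebius H" "\<And>x. H (G x) = x" "\<And>x. G (H x) = x"
    by (rule moebius_inverse[OF t(1)]) blast
  define T where "T = G \<circ> R \<circ> H"
  have T: "moebius_involution T"
    unfolding T_def by (rule moebius_involution_conjugate[OF R(1) t(1) H])
  have TT: "T (T x) = x" for x by (simp add: T_def RR H)
  have low: "T (corner w z 1) = corner w z 4" "T (corner w z 2) = corner w z 5" "T (corner w z 3) = corner w z 6"
    by (simp_all only: T_def c comp_apply H(2) R)
  have "T (corner w z k) = corner w z (k + 3)" for k
  proof (rule periodic_all[where P = "\<lambda>k. T (corner w z k) = corner w z (k + 3)"])
    fix k :: nat
    have "corner w z 7 = corner w z 1" "corner w z 8 = corner w z 2" "corner w z 9 = corner w z 3"
      using corner_periodic[of w z 1] corner_periodic[of w z 2] corner_periodic[of w z 3] by simp_all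
    moreover have "T (corner w z 4) = corner w z 1" "T (corner w z 5) = corner w z 2" "T (corner w z 6) = corner w z 3"
      unfolding low[symmetric] by (rule TT)+
    moreover assume "k \<in> {1..6}"
    then have "k = 1 \<or> k = 2 \<or> k = 3 \<or> k = 4 \<or> k = 5 \<or> k = 6" by force
    ultimately show "T (corner w z k) = corner w z (k + 3)"
      using low by (elim disjE) simp_all
  next
    have "k + 6 + 3 = k + 3 + 6" for k :: nat by simp
    then show "T (corner w z (k + 6)) = corner w z (k + 6 + 3) \<longleftrightarrow> T (corner w z k) = corner w z (k + 3)" for k
      by (simp only: corner_periodic)
  qed
  then show ?thesis using that T by blast
qed

text \<open>The involution exchanging opposite corners preserves the central circle. The image of
a petal passes through the same two corners as the opposite petal and meets the central
circle at the same oriented angle, so that two cross-ratios differ by a positive factor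
only. The quotient of these cross-ratios is itself a cross-ratio, and since it is real, the
two circles coincide.\<close>

lemma symmetric_flowerI:
  assumes ang: "\<And>k. intersection_angle w z (k + 3) = intersection_angle w z k"
    and "corner_multi_ratio w z = - 1"
  shows "conformally_symmetric_flower w z"
proof -
  obtain T where T: "moebius_involution T" "\<And>k. T (corner w z k) = corner w z (k + 3)"
    using corner_involution[OF assms(2)] by blast
  then have "moebius T" by (simp add: moebius_involution_def)
  note inj = moebius_inj[OF \<open>moebius T\<close>]
  have "T ` circle_at w z = circle_at w z"
  proof (rule circle_atI[OF w z, of _ 4 5 6])
    have "corner w z 4 = T (corner w z 1)" "corner w z 5 = T (corner w z 2)" "corner w z 6 = T (corner w z 3)"
      by (simp_all add: T)
    then show "corner w z 4 \<in> T ` circle_at w z" "corner w z 5 \<in> T ` circle_at w z"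
      "corner w z 6 \<in> T ` circle_at w z"
      using corner_in_circle_at[OF w z] by (simp_all only: imageI)
  qed (use is_circle_image \<open>moebius T\<close> circle_at_is_circle[OF w z] in auto)
  moreover have "T ` circle_at w (petal z k) = circle_at w (petal z (k + 3))" for k
  proof -
    define p q v r r' where "p = corner w z (k + 3)" and "q = corner w z (k + 3 + 1)"
      and "v = corner w z (k + 3 + 2)" and "r = T (corner w (petal z k) (k + 5))"
      and "r' = corner w (petal z (k + 3)) (k + 3 + 5)"
    have e: "k + 3 + 1 = k + 1 + 3" "k + 3 + 2 = k + 2 + 3" by auto
    have pq: "p = T (corner w z k)" "q = T (corner w z (k + 1))" "v = T (corner w z (k + 2))"
      unfolding T p_def q_def v_def e by auto
    have d: "r \<noteq> p" "r \<noteq> q" "r' \<noteq> p" "r' \<noteq> q"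
      using outer_corner_distinct[OF w z, of k] outer_corner_distinct[OF w z, of "k + 3"]
      unfolding r_def pq inj unfolding pq[symmetric] r'_def p_def q_def by auto
    have d': "p \<noteq> q" "v \<noteq> p" "v \<noteq> q"
      using corner_distinct[OF w z, of k "k + 1"] corner_distinct[OF w z, of k "k + 2"]
        corner_distinct[OF w z, of "k + 1" "k + 2"] unfolding pq inj by auto
    have "intersection_angle w z k = Arg2pi (cross_ratio p q r v)"
      unfolding pq r_def moebius_cross_ratio[OF \<open>moebius T\<close>] by (rule angle_eq[OF w z])
    moreover have "intersection_angle w z (k + 3) = Arg2pi (cross_ratio p q r' v)"
      unfolding p_def q_def v_def r'_def by (rule angle_eq[OF w z])
    ultimately have "Arg2pi (cross_ratio p q r' v) = Arg2pi (cross_ratio p q r v)"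
      using ang by simp
    then obtain x :: real where "cross_ratio p q r' v = of_real x * cross_ratio p q r v"
      using d d' Arg2pi_eq_iff cross_ratio_nonzero by metis
    then have "cross_ratio p q r' r = of_real x"
      using cross_ratio_quotient[of v p q r r'] cross_ratio_nonzero[of r p q v] d d' by simp
    then have "r \<in> circle_at w (petal z (k + 3))"
      using circle_iff_cross_ratio_real[of "circle_at w (petal z (k + 3))" p q r' r] d d'
        circle_at_is_circle[OF w petal_in_faces[OF z]] corners_in_petal_circle[OF w z, of "k + 3"]
      unfolding p_def q_def r'_def by auto
    show ?thesis
    proof (rule circle_unique)
      show "is_circle (T ` circle_at w (petal z k))"
        by (intro is_circle_image \<open>moebius T\<close> circle_at_is_circle[OF w petal_in_faces[OF z]])
      show "p \<in> T ` circle_at w (petal z k)" "q \<in> T ` circle_at w (petal z k)" "r \<in> T ` circle_at w (petal z k)"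
        unfolding pq r_def using corners_in_petal_circle[OF w z] by blast+
      show "p \<in> circle_at w (petal z (k + 3))" "q \<in> circle_at w (petal z (k + 3))"
        unfolding p_def q_def using corners_in_petal_circle[OF w z] by blast+
    qed (use \<open>r \<in> _\<close> d d' circle_at_is_circle[OF w petal_in_faces[OF z]] in auto)
  qed
  ultimately show ?thesis
    unfolding conformally_symmetric_flower_def using T(1) by (intro exI[of _ T]) simp
qed

end

lemma opposite_angles_all:
  assumes "\<And>i. i \<in> {1..3} \<Longrightarrow> intersection_angle w z i = intersection_angle w z (i + 3)"
  shows "intersection_angle w z (k + 3) = intersection_angle w z k"
proof (rule periodic_all[where P = "\<lambda>k. intersection_angle w z (k + 3) = intersection_angle w z k"])
  show "intersection_angle w z (k + 3) = intersection_angle w z k" if "k \<in> {1..6}" for k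
  proof (cases "k \<le> 3")
    case True
    then show ?thesis using assms[of k] that by simp
  next
    case False
    define i where "i = k - 3"
    have "k = i + 3" "i \<in> {1..3}" "i + 3 + 3 = i + 6" using False that by (auto simp: i_def)
    then show ?thesis using assms[of i] by (simp only: intersection_angle_periodic)
  qed
  have "k + 6 + 3 = k + 3 + 6" for k :: nat by simp
  then show "intersection_angle w z (k + 6 + 3) = intersection_angle w z (k + 6) \<longleftrightarrow>
      intersection_angle w z (k + 3) = intersection_angle w z k" for k
    by (simp only: intersection_angle_periodic)
qed

lemma symmetric_flower_iff:
  assumes w: "hexagonal_circle_pattern w" and z: "z \<in> hex_faces" and "proper_flower w z"
  shows "conformally_symmetric_flower w z \<longleftrightarrow>
    (\<forall>i\<in>{1..3}. intersection_angle w z i = intersection_angle w z (i + 3)) \<and> corner_multi_ratio w z = - 1"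
  using symmetric_flowerD[OF w z assms(3)] symmetric_flowerI[OF w z] opposite_angles_all[of w z] by metis

section \<open>Intersection angles across the pattern\<close>

lemma corner_cross_ratio_nonzero:
  assumes "hexagonal_circle_pattern w" "z \<in> hex_faces"
    and "2 \<le> i" "i \<le> 5" "5 \<le> j" "j \<le> 8"
  shows "cross_ratio (corner w z k) (corner w z (k + 1)) (corner w (petal z k) (k + j)) (corner w z (k + i)) \<noteq> 0"
proof (rule cross_ratio_nonzero)
  note petal_ne = corner_distinct[OF assms(1) petal_in_faces[OF assms(2)]]
  show "corner w (petal z k) (k + j) \<noteq> corner w z k" "corner w (petal z k) (k + j) \<noteq> corner w z (k + 1)"
    using petal_ne[of "k + 4" "k + j" k] petal_ne[of "k + 3" "k + j" k] assms
    unfolding petal_corner(1,2) by auto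
  show "corner w z (k + i) \<noteq> corner w z k" "corner w z (k + i) \<noteq> corner w z (k + 1)"
    using corner_distinct[OF assms(1,2), of k "k + i"] corner_distinct[OF assms(1,2), of "k + 1" "k + i"] assms by auto
qed

text \<open>Relations between angles modulo \<open>2 * pi\<close> become multiplicative for these unit complex
numbers.\<close>

definition angle_unit :: "(complex \<Rightarrow> rsphere) \<Rightarrow> complex \<Rightarrow> nat \<Rightarrow> complex" where
  "angle_unit w z k = cis (intersection_angle w z k)"

lemma angle_unit_eq:
  assumes "hexagonal_circle_pattern w" "z \<in> hex_faces"
    and "2 \<le> i" "i \<le> 5" "5 \<le> j" "j \<le> 8"
  shows "angle_unit w z k =
    sgn (cross_ratio (corner w z k) (corner w z (k + 1)) (corner w (petal z k) (k + j)) (corner w z (k + i)))"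
  unfolding angle_unit_def intersection_angle_eq[OF assms]
  by (rule sgn_eq_cis_Arg2pi[symmetric, OF corner_cross_ratio_nonzero[OF assms]])

lemma intersection_angle_eq_iff:
  assumes "hexagonal_circle_pattern w" "z \<in> hex_faces" "z' \<in> hex_faces"
  shows "intersection_angle w z k = intersection_angle w z' k' \<longleftrightarrow> angle_unit w z k = angle_unit w z' k'"
proof
  have *: "Arg2pi (angle_unit w z k) = intersection_angle w z k" if "z \<in> hex_faces" for z k
  proof (rule Arg2pi_unique)
    show "of_real 1 * exp (\<i> * of_real (intersection_angle w z k)) = angle_unit w z k"
      by (simp add: angle_unit_def cis_conv_exp)
    show "0 \<le> intersection_angle w z k" "intersection_angle w z k < 2 * pi"
      unfolding angle_eq[OF assms(1) that] using Arg2pi by auto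
  qed simp
  show "angle_unit w z k = angle_unit w z' k' \<Longrightarrow> intersection_angle w z k = intersection_angle w z' k'"
    using * assms by metis
qed (simp add: angle_unit_def)

lemma angle_unit_periodic: "angle_unit w z (k + 6) = angle_unit w z k"
  by (simp add: angle_unit_def intersection_angle_periodic)

text \<open>The angle belongs to the edge: seen from the petal, the same cross-ratio occurs with
both pairs of points exchanged.\<close>

lemma angle_unit_petal:
  assumes "hexagonal_circle_pattern w" "z \<in> hex_faces"
  shows "angle_unit w (petal z k) (k + 3) = angle_unit w z k"
proof -
  have e: "k + 3 + 1 = k + 4" "k + 3 + 2 = k + 5" "k + 3 + 5 = k + 2 + 6" by auto
  have "angle_unit w (petal z k) (k + 3) =
      sgn (cross_ratio (corner w z (k + 1)) (corner w z k) (corner w z (k + 2)) (corner w (petal z k) (k + 5)))"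
    using angle_unit_eq[OF assms(1) petal_in_faces[OF assms(2)], of 2 5 k "k + 3"]
      corner_periodic[of w z "k + 2"]
    by (simp add: e petal_petal petal_corner(1,2) corner_periodic del: add_2_eq_Suc' One_nat_def)
  also have "\<dots> = angle_unit w z k"
    using angle_unit_eq[OF assms, of 2 5 k] by (simp only: cross_ratio_swap)
  finally show ?thesis .
qed

lemma cross_ratio_cycle:
  assumes "a \<noteq> b" "b \<noteq> c" "c \<noteq> a" "v \<noteq> a" "v \<noteq> b" "v \<noteq> c"
  shows "cross_ratio v a b c * cross_ratio v b c a * cross_ratio v c a b = - 1"
proof -
  have "sdiff a b = - sdiff b a" "sdiff b c = - sdiff c b" "sdiff a c = - sdiff c a"
    by (rule sdiff_swap)+
  moreover have "sdiff a v \<noteq> 0" "sdiff b v \<noteq> 0" "sdiff c v \<noteq> 0" "sdiff b a \<noteq> 0" "sdiff c b \<noteq> 0" "sdiff c a \<noteq> 0"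
    using assms by (auto simp: sdiff_eq_0_iff)
  ultimately show ?thesis unfolding cross_ratio_def by simp
qed

text \<open>At a vertex \<open>v\<close> three circles meet, and with tangents \<open>t\<close>, \<open>t'\<close>, \<open>t''\<close> the product is
\<open>(- t' / t) (- t'' / t') (- t / t'') = - 1\<close>. In terms of points, all three angles are
expressed by \<open>v\<close> and its three neighbours in the lattice.\<close>

lemma angle_unit_product_at_vertex:
  assumes w: "hexagonal_circle_pattern w" and z: "z \<in> hex_faces"
  shows "angle_unit w z k * angle_unit w (petal z k) (k + 4) * angle_unit w (petal z (k + 5)) (k + 8) = - 1"
proof -
  define v a b c where "v = corner w z k" and "a = corner w z (k + 1)"
    and "b = corner w (petal z k) (k + 5)" and "c = corner w z (k + 5)"
  have pk: "petal z k \<in> hex_faces" "petal z (k + 5) \<in> hex_faces" using z petal_in_faces by auto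
  have e: "k + 5 + 3 = k + 8" "k + 5 + 4 = k + 9" "k + 5 + 1 = k + 6" "k + 4 + 5 = k + 9" "k + 4 + 1 = k + 5"
    "k + 3 + 6 = k + 9" "k + 8 + 5 = k + 7 + 6" "k + 8 + 1 = k + 9" by auto
  have "corner w (petal z k) (k + 9) = a"
    using petal_corner(2)[of w z k] corner_periodic[of w "petal z k" "k + 3"] by (simp only: a_def e)
  moreover have "corner w (petal z (k + 5)) (k + 9) = c"
    using petal_corner(1)[of w z "k + 5"] by (simp only: c_def e)
  moreover have "corner w (petal z (k + 5)) (k + 8) = v"
    using petal_corner(2)[of w z "k + 5"] by (simp only: v_def e corner_periodic)
  moreover have "corner w (petal z (k + 5)) (k + 7) = b"
    using petal_corner(3)[of w z k] by (simp only: b_def)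
  moreover have "petal (petal z (k + 5)) (k + 8) = z"
    using petal_petal(1)[of z "k + 5"] by (simp only: e)
  moreover have "corner w z (k + 7 + 6) = a"
    using corner_periodic[of w z "k + 1"] corner_periodic[of w z "k + 7"] by (simp add: a_def add.commute)
  ultimately have
    "angle_unit w (petal z k) (k + 4) = sgn (cross_ratio v b c a)"
    "angle_unit w (petal z (k + 5)) (k + 8) = sgn (cross_ratio v c a b)"
    using angle_unit_eq[OF w pk(1), of 5 5 "k + 4"] angle_unit_eq[OF w pk(2), of 5 5 "k + 8"]
      corner_periodic[of w "petal z (k + 5)" "k + 7"]
    by (simp_all add: e petal_petal petal_corner(1) corner_periodic v_def[symmetric] b_def[symmetric] del: One_nat_def)
  moreover have "angle_unit w z k = sgn (cross_ratio v a b c)"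
    using angle_unit_eq[OF w z, of 5 5 k] by (simp add: v_def a_def b_def c_def)
  ultimately have "angle_unit w z k * angle_unit w (petal z k) (k + 4) * angle_unit w (petal z (k + 5)) (k + 8) =
      sgn (cross_ratio v a b c * cross_ratio v b c a * cross_ratio v c a b)"
    by (simp add: sgn_mult)
  moreover have "a \<noteq> b" "v \<noteq> b" using outer_corner_distinct[OF w z, of k] by (auto simp: a_def b_def v_def)
  moreover have "c \<noteq> a" "v \<noteq> a" "v \<noteq> c"
    using corner_distinct[OF w z, of "k + 1" "k + 5"] corner_distinct[OF w z, of k "k + 1"]
      corner_distinct[OF w z, of k "k + 5"] by (auto simp: a_def c_def v_def)
  moreover have "b \<noteq> c"
    using corner_distinct[OF w pk(2), of "k + 7" "k + 9"]
      \<open>corner w (petal z (k + 5)) (k + 9) = c\<close> \<open>corner w (petal z (k + 5)) (k + 7) = b\<close> by simp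
  ultimately show ?thesis by (simp add: cross_ratio_cycle sgn_minus)
qed

text \<open>The vertex \<open>r\<close> outside the central hexagon next to the corner \<open>k + 1\<close> lies on both
petals that meet there. On which side of the central circle \<open>r\<close> lies decides, for either
petal, whether the intersection angle is smaller or larger than \<open>pi\<close>; so the answer is the
same for both. If \<open>\<xi>\<close> is the cross-ratio for one angle, the one for the other is \<open>1 / (1 -
\<xi>)\<close>, and this map preserves the upper half-plane.\<close>

lemma angle_units_same_half_plane:
  assumes w: "hexagonal_circle_pattern w" and z: "z \<in> hex_faces" and "proper_flower w z"
  shows "0 < Im (angle_unit w z k) * Im (angle_unit w z (k + 1))"
proof -
  define a v b r where "a = corner w z k" and "v = corner w z (k + 1)"
    and "b = corner w z (k + 2)" and "r = corner w (petal z k) (k + 8)"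
  have ne: "a \<noteq> v" "a \<noteq> b" "v \<noteq> b"
    using corner_distinct[OF w z, of k "k + 1"] corner_distinct[OF w z, of k "k + 2"]
      corner_distinct[OF w z, of "k + 1" "k + 2"] by (auto simp: a_def v_def b_def)
  have r_ne: "r \<noteq> a" "r \<noteq> v"
    using corner_distinct[OF w petal_in_faces[OF z], of "k + 4" "k + 8" k]
      corner_distinct[OF w petal_in_faces[OF z], of "k + 3" "k + 8" k]
    unfolding petal_corner(1,2) a_def v_def r_def by auto
  have "r \<notin> circle_at w z"
    using centre_meets_petal[OF w z assms(3), of k] r_ne corner_in_circle_at[OF w petal_in_faces[OF z], of k "k + 8"]
    unfolding a_def v_def r_def by blast
  define \<xi> where "\<xi> = cross_ratio a v r b"
  have "\<xi> \<notin> \<real>"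
  proof
    assume "\<xi> \<in> \<real>"
    then have "1 / \<xi> \<in> \<real>" by simp
    moreover have "cross_ratio a v b r = 1 / \<xi>" by (simp add: \<xi>_def cross_ratio_def mult.commute)
    ultimately show False
      using circle_iff_cross_ratio_real[OF circle_at_is_circle[OF w z], of a v b r] ne
        corner_in_circle_at[OF w z] \<open>r \<notin> circle_at w z\<close> by (auto simp: a_def v_def b_def)
  qed
  have "r \<noteq> b" using \<open>r \<notin> circle_at w z\<close> corner_in_circle_at[OF w z] by (auto simp: b_def)
  have "cross_ratio v b r a = 1 / (1 - \<xi>)"
  proof -
    have "sdiff r v * sdiff b a - sdiff r a * sdiff b v = sdiff r b * sdiff v a"
      using sdiff_pluecker[of r v b a] sdiff_swap[of v b] sdiff_swap[of v a] by algebra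
    moreover have "sdiff a b = - sdiff b a" "sdiff a v = - sdiff v a" by (rule sdiff_swap)+
    moreover have "sdiff r v \<noteq> 0" "sdiff b a \<noteq> 0" "sdiff r b \<noteq> 0" "sdiff v a \<noteq> 0"
      using r_ne ne \<open>r \<noteq> b\<close> by (auto simp: sdiff_eq_0_iff)
    ultimately show ?thesis
      unfolding \<xi>_def cross_ratio_def by (simp add: divide_simps)
  qed
  have 1: "angle_unit w z k = sgn \<xi>"
    using angle_unit_eq[OF w z, of 2 8 k] by (simp add: \<xi>_def a_def v_def b_def r_def)
  have e: "k + 1 + 5 = k + 6" "k + 1 + 1 = k + 2" "k + 1 + 7 = k + 8" by auto
  have "corner w (petal z (k + 1)) (k + 6) = r"
    using petal_corner(3)[of w z "k + 1"] by (simp only: e petal_periodic r_def)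
  then have 2: "angle_unit w z (k + 1) = sgn (1 / (1 - \<xi>))"
    using angle_unit_eq[OF w z, of 5 5 "k + 1"] \<open>cross_ratio v b r a = 1 / (1 - \<xi>)\<close>
    by (simp only: e corner_periodic a_def v_def b_def)
  have "Im \<xi> \<noteq> 0" using \<open>\<xi> \<notin> \<real>\<close> by (simp add: complex_is_Real_iff)
  then have "0 < (Im \<xi>)\<^sup>2 / (cmod \<xi> * cmod (1 / (1 - \<xi>)) * (cmod (1 - \<xi>))\<^sup>2)"
    by (intro divide_pos_pos mult_pos_pos) auto
  also have "\<dots> = Im (sgn \<xi>) * Im (sgn (1 / (1 - \<xi>)))"
  proof -
    have sgn: "Im (sgn x) = Im x / cmod x" for x by (simp add: sgn_eq)
    have inv: "Im (1 / (1 - \<xi>)) = Im \<xi> / (cmod (1 - \<xi>))\<^sup>2"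
      by (simp add: Im_divide cmod_power2)
    show ?thesis unfolding sgn inv by (simp add: power2_eq_square)
  qed
  finally show ?thesis unfolding 1 2 .
qed

text \<open>Let \<open>a\<close>, \<open>b\<close>, \<open>c\<close> be the three values at the face \<open>z\<close>. Equality of opposite angles
keeps \<open>a\<close> constant along the strip of faces through the edge \<open>k\<close>, and the relation at the
vertices expresses the other two values at the neighbour \<open>y\<close> as \<open>- 1 / (c a)\<close> and \<open>- 1 / (a
b)\<close>. Going to a third face \<open>y'\<close> adjacent to both gives \<open>(a b c)\<^sup>2 = 1\<close>. These algebraic
relations alone allow \<open>a b c = 1\<close>, with \<open>b\<close> and \<open>c\<close> changing sign from \<open>z\<close> to \<open>y\<close>. It is
excluded by the cyclic order of the vertices: \<open>b\<close> has to be in the same half-plane as \<open>a\<close>,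
and so has \<open>- b\<close>. Hence \<open>a b c = - 1\<close>, and nothing changes from \<open>z\<close> to \<open>y\<close>.\<close>

lemma opposite_angles_shift_invariant:
  assumes w: "hexagonal_circle_pattern w" and z: "z \<in> hex_faces"
    and proper: "\<And>z. z \<in> hex_faces \<Longrightarrow> proper_flower w z"
    and opp: "\<And>z k. z \<in> hex_faces \<Longrightarrow> angle_unit w z (k + 3) = angle_unit w z k"
  shows "angle_unit w (petal z k) j = angle_unit w z j"
proof -
  let ?X = "angle_unit w"
  \<comment> \<open>the relation at the corner \<open>k + 1\<close> of \<open>z\<close>; the third edge there points outwards\<close>
  have vertex: "?X z k * ?X z (k + 1) * ?X (petal z (k + 1)) (k + 2) = - 1" if z: "z \<in> hex_faces" for z k
  proof -
    have e: "k + 1 + 4 = k + 2 + 3" "k + 1 + 5 = k + 6" "k + 1 + 8 = k + 3 + 6" by auto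
    show ?thesis
      using angle_unit_product_at_vertex[OF w z, of "k + 1"] petal_in_faces[OF z] angle_unit_petal[OF w z, of k]
      by (simp only: e petal_periodic angle_unit_periodic opp mult_ac)
  qed
  define y y' where "y = petal z k" and "y' = petal z (k + 1)"
  have F: "y \<in> hex_faces" "y' \<in> hex_faces" using petal_in_faces[OF z] by (simp_all add: y_def y'_def)
  define a b c where "a = ?X z k" and "b = ?X z (k + 1)" and "c = ?X z (k + 2)"
  \<comment> \<open>\<open>y\<close> and \<open>z\<close> share the edge \<open>k\<close> of \<open>z\<close>, which is opposite to the edge \<open>k\<close> of \<open>y\<close>\<close>
  have ay: "?X y k = a"
    using angle_unit_petal[OF w z, of k] opp[OF F(1)] by (simp add: y_def a_def)
  have e: "k + 5 = k + 2 + 3" "k + 5 + 1 = k + 6" "k + 5 + 2 = k + 1 + 6" "k + 2 + 1 = k + 3"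
    "k + 2 + 2 = k + 1 + 3" "k + 1 + 1 = k + 2" "k + 1 + 2 = k + 3"
    "k + 3 + 1 = k + 1 + 3" "k + 3 + 2 = k + 2 + 3" by auto
  have by': "c * a * ?X y (k + 1) = - 1"
  proof -
    have "k + 5 = k + 2 + 3" "k + 5 + 1 = k + 6" "k + 5 + 2 = k + 1 + 6" by auto
    then have "?X z (k + 5) = c" "?X z (k + 5 + 1) = a" "petal z (k + 5 + 1) = y" "?X y (k + 5 + 2) = ?X y (k + 1)"
      by (simp_all only: opp[OF z] angle_unit_periodic petal_periodic a_def c_def y_def)
    then show ?thesis using vertex[OF z, of "k + 5"] by simp
  qed
  have cy: "?X y (k + 2) * a * b = - 1"
    using vertex[OF F(1), of "k + 2"] opp[OF F(1)] opp[OF z] ay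
    by (simp only: e y_def petal_petal b_def)
  have ay': "?X y' k * b * c = - 1"
    using vertex[OF F(2), of "k + 3"] opp[OF F(2), of k] angle_unit_petal[OF w z, of "k + 1"]
      petal_petal(1)[of z "k + 1"] opp[OF z, of "k + 2"]
    by (simp only: e y'_def b_def c_def)
  \<comment> \<open>the relation at the corner \<open>k + 2\<close> of \<open>y\<close>, whose outer edge is the edge \<open>k + 3\<close> of \<open>y'\<close>\<close>
  have "?X y (k + 1) * ?X y (k + 2) * ?X y' k = - 1"
    using vertex[OF F(1), of "k + 1"] opp[OF F(2), of k]
    by (simp only: e y_def y'_def petal_petal)
  then have "(a * b * c)\<^sup>2 = 1" using by' cy ay' by algebra
  then have "a * b * c = 1 \<or> a * b * c = - 1" by (simp add: power2_eq_1_iff)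
  moreover have "a * b * c \<noteq> 1"
  proof
    assume "a * b * c = 1"
    then have "?X y (k + 1) = - b" using by' by algebra
    then have "0 < Im a * Im b" "0 < Im a * - Im b"
      using angle_units_same_half_plane[OF w z proper[OF z], of k]
        angle_units_same_half_plane[OF w F(1) proper[OF F(1)], of k] ay by (auto simp: a_def b_def)
    then show False by simp
  qed
  ultimately have "a * b * c = - 1" by blast
  then have bc: "?X y (k + 1) = b" "?X y (k + 2) = c" using by' cy by algebra+
  \<comment> \<open>three consecutive indices suffice, as both sides have period 3\<close>
  have P3: "?X y (i + 3) = ?X z (i + 3) \<longleftrightarrow> ?X y i = ?X z i" for i by (simp only: opp[OF z] opp[OF F(1)])
  have "?X y (k + n) = ?X z (k + n)" for n
  proof (induction n rule: less_induct)
    case (less n)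
    consider "n = 0" | "n = 1" | "n = 2" | m where "n = m + 3"
    proof -
      have "n = 0 \<or> n = 1 \<or> n = 2 \<or> n = (n - 3) + 3" by arith
      then show ?thesis using that by blast
    qed
    then show ?case
    proof cases
      case (4 m)
      then show ?thesis using less[of m] P3[of "k + m"] by (simp add: add.assoc)
    qed (use ay bc in \<open>simp_all add: a_def b_def c_def\<close>)
  qed
  moreover have "?X y (i + 3 * m) = ?X z (i + 3 * m) \<longleftrightarrow> ?X y i = ?X z i" for i m
  proof (induction m)
    case (Suc m)
    then show ?case using P3[of "i + 3 * m"] by (simp add: add.commute add.left_commute)
  qed simp
  moreover have "j + 3 * k = k + (j + 2 * k)" by simp
  ultimately show ?thesis unfolding y_def by metis
qed

lemma opposite_angles_constant:
  assumes w: "hexagonal_circle_pattern w" and z: "z \<in> hex_faces"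
    and proper: "\<And>z. z \<in> hex_faces \<Longrightarrow> proper_flower w z"
    and opp: "\<And>z k. z \<in> hex_faces \<Longrightarrow> angle_unit w z (k + 3) = angle_unit w z k"
  shows "angle_unit w z j = angle_unit w 0 j"
proof -
  let ?u = "1 + \<epsilon>" and ?v = "\<epsilon> + \<epsilon>\<^sup>2"
  note shift = opposite_angles_shift_invariant[OF w _ proper opp, where j = j]
  have face: "of_int m * ?u + of_int n * ?v \<in> hex_faces" for m n unfolding hex_faces_iff by blast
  have v: "angle_unit w (of_int m * ?u + of_int (n + 1) * ?v) j = angle_unit w (of_int m * ?u + of_int n * ?v) j" for m n
    using shift[OF face[of m n], of 1] by (simp add: petal_def algebra_simps power2_eq_square)
  have u: "angle_unit w (of_int (m + 1) * ?u) j = angle_unit w (of_int m * ?u) j" for m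
    using shift[OF face[of m 0], of 0] by (simp add: petal_def algebra_simps)
  have u0: "angle_unit w (of_int m * ?u) j = angle_unit w 0 j" for m
  proof (induction m rule: int_induct[where k = 0])
    case (step2 m)
    then show ?case using u[of "m - 1"] by simp
  qed (use u in simp_all)
  have "angle_unit w (of_int m * ?u + of_int n * ?v) j = angle_unit w (of_int m * ?u) j" for m n
  proof (induction n rule: int_induct[where k = 0])
    case (step2 n)
    then show ?case using v[of m "n - 1"] by simp
  qed (use v in simp_all)
  then show ?thesis using z u0 unfolding hex_faces_iff by metis
qed

lemma constant_angles_iff:
  assumes w: "hexagonal_circle_pattern w"
    and proper: "\<And>z. z \<in> hex_faces \<Longrightarrow> proper_flower w z"
  shows "constant_intersection_angles w \<longleftrightarrow>
    (\<forall>z\<in>hex_faces. \<forall>i\<in>{1..3}. intersection_angle w z i = intersection_angle w z (i + 3))"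
proof
  assume const: "constant_intersection_angles w"
  have "intersection_angle w z i = intersection_angle w z (i + 3)" if z: "z \<in> hex_faces" and i: "i \<in> {1..3}" for z i
  proof -
    note eps_powers_omega
    moreover have "i = 1 \<or> i = 2 \<or> i = 3" using i by auto
    ultimately have "\<epsilon> ^ (i + 2) \<in> {- 1, - \<omega>, \<omega>\<^sup>2}" by blast
    then obtain u where u: "u \<in> {1, \<omega>, \<omega>\<^sup>2}" "\<epsilon> ^ (i + 2) \<in> {u, - u}" by blast
    have "\<epsilon> ^ (i + 3 + 2) \<in> {u, - u}" using u(2) eps_shift(3)[of "i + 2"] by (auto simp: add.commute)
    moreover obtain \<phi> where "\<And>k. k \<in> {1..6} \<Longrightarrow> \<epsilon> ^ (k + 2) \<in> {u, - u} \<Longrightarrow> intersection_angle w z k = \<phi>"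
      using const[unfolded constant_intersection_angles_def edge_direction, rule_format, OF u(1)] z by blast
    moreover have "i \<in> {1..6}" "i + 3 \<in> {1..6}" using i by auto
    ultimately show ?thesis using u(2) by metis
  qed
  then show "\<forall>z\<in>hex_faces. \<forall>i\<in>{1..3}. intersection_angle w z i = intersection_angle w z (i + 3)" by blast
next
  assume opp: "\<forall>z\<in>hex_faces. \<forall>i\<in>{1..3}. intersection_angle w z i = intersection_angle w z (i + 3)"
  show "constant_intersection_angles w" unfolding constant_intersection_angles_def
  proof
    fix u assume "u \<in> {1, \<omega>, \<omega>\<^sup>2}"
    moreover note eps_powers_omega
    ultimately obtain j where j: "\<epsilon> ^ (j + 2) \<in> {u, - u}" by (metis insert_iff minus_minus singletonD)
    have X3: "angle_unit w z (k + 3) = angle_unit w z k" if "z \<in> hex_faces" for z k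
      using opposite_angles_all[OF opp[rule_format, OF that]] by (simp add: angle_unit_def)
    have "intersection_angle w z k = intersection_angle w 0 j"
      if z: "z \<in> hex_faces" and k: "\<epsilon> ^ (k + 2) \<in> {u, - u}" for z k
    proof -
      have e: "n + 3 + 4 = n + 4 + 3" "n + 2 + 4 = n + 6" for n :: nat by auto
      have 0: "0 \<in> hex_faces" unfolding hex_faces_iff by (intro exI[of _ 0]) simp
      \<comment> \<open>indices are shifted by 4 because the edge \<open>k\<close> has direction \<open>\<epsilon> ^ (k + 2)\<close> and \<open>2 + 4 = 6\<close>\<close>
      have "angle_unit w 0 (k + 2 + 4) = angle_unit w 0 (j + 2 + 4)"
        by (rule eps_power_eq_up_to_sign[of "\<lambda>n. angle_unit w 0 (n + 4)", OF _ k j]) (simp only: e X3[OF 0])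
      then have "angle_unit w z k = angle_unit w 0 j"
        using opposite_angles_constant[OF w z proper X3, of k] by (simp only: e angle_unit_periodic)
      then show ?thesis using intersection_angle_eq_iff[OF w z 0] by blast
    qed
    then show "\<exists>\<phi>. \<forall>z\<in>hex_faces. \<forall>k\<in>{1..6}.
      (z + \<epsilon> ^ (k + 1)) - (z + \<epsilon> ^ k) \<in> {u, - u} \<longrightarrow> intersection_angle w z k = \<phi>"
      unfolding edge_direction by blast
  qed
qed

theorem proposition5p2:
  fixes w :: "complex \<Rightarrow> rsphere"
  assumes "hexagonal_circle_pattern w"
  shows "(\<forall>z\<in>hex_faces. proper_flower w z \<longrightarrow>
            (conformally_symmetric_flower w z \<longleftrightarrow>
              (\<forall>i\<in>{1..3}. intersection_angle w z i = intersection_angle w z (i + 3)) \<and>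
              corner_multi_ratio w z = - 1)) \<and>
         ((\<forall>z\<in>hex_faces. proper_flower w z) \<longrightarrow>
            (conformally_symmetric_pattern w \<longleftrightarrow>
              constant_intersection_angles w \<and>
              (\<forall>z\<in>hex_faces. corner_multi_ratio w z = - 1)))"
proof (intro conjI impI)
  show "\<forall>z\<in>hex_faces. proper_flower w z \<longrightarrow>
            (conformally_symmetric_flower w z \<longleftrightarrow>
              (\<forall>i\<in>{1..3}. intersection_angle w z i = intersection_angle w z (i + 3)) \<and>
              corner_multi_ratio w z = - 1)"
    using symmetric_flower_iff[OF assms] by blast
next
  assume proper: "\<forall>z\<in>hex_faces. proper_flower w z"
  then have "conformally_symmetric_pattern w \<longleftrightarrow>
      (\<forall>z\<in>hex_faces. \<forall>i\<in>{1..3}. intersection_angle w z i = intersection_angle w z (i + 3)) \<and>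
      (\<forall>z\<in>hex_faces. corner_multi_ratio w z = - 1)"
    unfolding conformally_symmetric_pattern_def using symmetric_flower_iff[OF assms] by simp blast
  then show "conformally_symmetric_pattern w \<longleftrightarrow>
      constant_intersection_angles w \<and> (\<forall>z\<in>hex_faces. corner_multi_ratio w z = - 1)"
    using constant_angles_iff[OF assms] proper by simp
qed
end
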